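(* Suppose $H$ is a three dimensional reproducing kernel Hilbert space, $X=X(H)=\{x_i\}_{i=1}^3$. The following are equivalent: (1) $H$ has the complete Pick property. (2) $H$ has the Pick property. (3) There exist $i\neq j$ with $\delta_H(x_i,x_j)=\delta_G(x_i,x_j)$. (4) $LF_{123}^2\le\delta_{13}^2$. (5) $$\frac{1}{|\widehat{k_{12}}|^2}+\frac1{|\widehat{k_{23}}|^2}+\frac1{|\widehat{k_{13}}|^2}-1\le\frac{2\cos A_{123}}{|\widehat{k_{12}}||\widehat{k_{23}}||\widehat{k_{13}}|}.$$ (6) There are $w\in\mathbb{C}$, $s>0$, $t\ge0$ such that, with $\Phi(x_1)=(0,0)$, $\Phi(x_2)=(s,0)$, $\Phi(x_3)=(w,t)$ and $\Phi(X)=\{(0,0),(s,0),(w,t)\}\subset\mathbb{B}^2=\mathbb{CH}^2$, we have $H\sim DA_2(\Phi(X))$ (with $x_i$ corresponding to $\Phi(x_i)$). Furthermore, the location of the points of $\Phi(X)$, the rescaling equivalence class of $H$, and the congruence class of the triangle with vertices $\Phi(X)$ are uniquely determined by the parameters $\{\delta_{12},\delta_{13},\delta_{23},A_{123}\}$.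
   Context: A finite dimensional reproducing kernel Hilbert space (RKHS) $H$ is a complex inner product space with a distinguished basis $\{k_i\}$ of reproducing kernels, indexed by $X(H)=\{x_i\}$; vectors are functions on $X(H)$ via $h(x_i)=\langle h,k_i\rangle$. Write $k_{ij}=\langle k_i,k_j\rangle$, $\widehat{k_{ij}}=k_{ii}^{-1/2}k_{jj}^{-1/2}k_{ij}$. Standing assumption: any two kernels are linearly independent and $k_{ij}\neq0$ for all $i,j$. Invariants: $\delta_{ij}=\delta_H(x_i,x_j)=(1-|\widehat{k_{ij}}|^2)^{1/2}$; $A_{123}=\arg(k_{12}k_{23}k_{31})$ with $|\arg|\le\pi$; $LF_{123}^2=\frac1{\delta_{12}^2}\left|1-\frac{k_{21}k_{13}}{k_{23}k_{11}}\right|^2$. Multipliers: for $m:X(H)\to\mathbb{C}$, $M_m$ is the operator $(M_mh)(x)=m(x)h(x)$ on $H$; $\operatorname{Mult}(H)$ is the algebra of all such operators with the operator norm. $\delta_G(x,y)=\sup\{\operatorname{Re}m(x):m\in\operatorname{Mult}(H),\ m(y)=0,\ \|m\|_{\operatorname{Mult}(H)}\le1\}$. Pick property: for $Y\subset X(H)$ let $H_Y$ be the RKHS spanned by $\{k_y\}_{y\in Y}$. $H$ has the Pick property if for every $Y\subset X(H)$ every multiplier of $H_Y$ of norm one extends to (is the restriction to $Y$ of the symbol of) a multiplier of $H$ of norm one. $H$ has the complete Pick property if the analogous extension statement holds for matrix-valued multipliers of every size. Rescaling: $H\sim\widetilde H$ if there are a bijection $\Xi:X(H)\to X(\widetilde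 H)$ and a nowhere vanishing $\gamma$ on $X(H)$ with $\langle\tilde k_{\Xi(x)},\tilde k_{\Xi(y)}\rangle=\gamma(x)\overline{\gamma(y)}\langle k_x,k_y\rangle$ for all $x,y$. $\mathbb{B}^n$ is the unit ball of $\mathbb{C}^n$ (model of complex hyperbolic space $\mathbb{CH}^n$); $DA_n$ is the Hilbert space of holomorphic functions on $\mathbb{B}^n$ with kernels $k_z(w)=(1-\langle w,z\rangle)^{-1}$; for finite $Y\subset\mathbb{B}^n$, $DA_n(Y)$ is the RKHS spanned by $\{k_y\}_{y\in Y}$. Two ordered sets in $\mathbb{B}^n$ are congruent if a biholomorphic automorphism of $\mathbb{B}^n$ maps one to the other respecting order. *)

theory Defs
  imports "HOL-Analysis.Analysis" "HOL-Library.Function_Algebras"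
begin

text \<open>
  A finite dimensional RKHS is stored as a linearly independent family of kernel vectors in a
  complex vector space; the Hilbert space itself is their span.  The inner product is linear in the
  first argument and is only constrained on that span.
\<close>

record ('p, 'v) rkhs =
  points :: "'p set"
  vscale :: "complex \<Rightarrow> 'v \<Rightarrow> 'v"
  ip :: "'v \<Rightarrow> 'v \<Rightarrow> complex"
  kern :: "'p \<Rightarrow> 'v"

definition vecs :: "('p, 'v::ab_group_add) rkhs \<Rightarrow> 'v set" where
  "vecs H = module.span (vscale H) (kern H ` points H)"

locale fin_rkhs = vector_space "vscale H" for H :: "('p, 'v::ab_group_add) rkhs" +
  assumes finite_points: "finite (points H)"
    and kern_inj: "inj_on (kern H) (points H)"
    and kern_independent: "independent (kern H ` points H)"
    and ip_add_left: "\<lbrakk>u \<in> vecs H; v \<in> vecs H; w \<in> vecs H\<rbrakk> \<Longrightarrow> ip H (u + v) w = ip H u w + ip H v w"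
    and ip_scale_left: "\<lbrakk>u \<in> vecs H; w \<in> vecs H\<rbrakk> \<Longrightarrow> ip H (vscale H c u) w = c * ip H u w"
    and ip_commute: "\<lbrakk>u \<in> vecs H; w \<in> vecs H\<rbrakk> \<Longrightarrow> ip H w u = cnj (ip H u w)"
    and ip_pos: "\<lbrakk>u \<in> vecs H; u \<noteq> 0\<rbrakk> \<Longrightarrow> 0 < Re (ip H u u)"

definition vnorm :: "('p, 'v) rkhs \<Rightarrow> 'v \<Rightarrow> real" where
  "vnorm H h = sqrt (Re (ip H h h))"

text \<open>The value of a vector, regarded as a function on the point set.\<close>

definition val :: "('p, 'v) rkhs \<Rightarrow> 'v \<Rightarrow> 'p \<Rightarrow> complex" where
  "val H h x = ip H h (kern H x)"

definition subrkhs :: "('p, 'v) rkhs \<Rightarrow> 'p set \<Rightarrow> ('p, 'v) rkhs" where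
  "subrkhs H Y = H\<lparr>points := Y\<rparr>"

definition gram :: "('p, 'v) rkhs \<Rightarrow> 'p \<Rightarrow> 'p \<Rightarrow> complex" where
  "gram H x y = ip H (kern H x) (kern H y)"

definition ngram :: "('p, 'v) rkhs \<Rightarrow> 'p \<Rightarrow> 'p \<Rightarrow> complex" where
  "ngram H x y =
     gram H x y / complex_of_real (sqrt (Re (gram H x x)) * sqrt (Re (gram H y y)))"

definition delta :: "('p, 'v) rkhs \<Rightarrow> 'p \<Rightarrow> 'p \<Rightarrow> real" where
  "delta H x y = sqrt (1 - (cmod (ngram H x y))\<^sup>2)"

definition angle :: "('p, 'v) rkhs \<Rightarrow> 'p \<Rightarrow> 'p \<Rightarrow> 'p \<Rightarrow> real" where
  "angle H x y z = Arg (gram H x y * gram H y z * gram H z x)"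

definition LF :: "('p, 'v) rkhs \<Rightarrow> 'p \<Rightarrow> 'p \<Rightarrow> 'p \<Rightarrow> real" where
  "LF H x y z =
     1 / delta H x y * cmod (1 - (gram H y x * gram H x z) / (gram H y z * gram H x x))"


text \<open>
  Since the kernels form a basis, every function on the (finite) point set is the symbol of a
  multiplier, so symbols range over all functions; values off the point set are irrelevant.
\<close>

definition mult_op :: "('p, 'v::ab_group_add) rkhs \<Rightarrow> ('p \<Rightarrow> complex) \<Rightarrow> 'v \<Rightarrow> 'v" where
  "mult_op H m h = (THE g. g \<in> vecs H \<and> (\<forall>x\<in>points H. val H g x = m x * val H h x))"

definition mult_norm :: "('p, 'v::ab_group_add) rkhs \<Rightarrow> ('p \<Rightarrow> complex) \<Rightarrow> real" where
  "mult_norm H m = (SUP h\<in>{h \<in> vecs H. vnorm H h \<le> 1}. vnorm H (mult_op H m h))"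

definition delta_G :: "('p, 'v::ab_group_add) rkhs \<Rightarrow> 'p \<Rightarrow> 'p \<Rightarrow> real" where
  "delta_G H x y = Sup {Re (m x) | m. m y = 0 \<and> mult_norm H m \<le> 1}"

definition pick_property :: "('p, 'v::ab_group_add) rkhs \<Rightarrow> bool" where
  "pick_property H \<longleftrightarrow>
     (\<forall>Y \<subseteq> points H. \<forall>m. mult_norm (subrkhs H Y) m = 1 \<longrightarrow>
        (\<exists>m'. (\<forall>y\<in>Y. m' y = m y) \<and> mult_norm H m' = 1))"

text \<open>
  A \<open>p \<times> q\<close> matrix-valued symbol is \<open>\<phi> x i j\<close> with \<open>i < p\<close>, \<open>j < q\<close>.  It acts from the
  \<open>q\<close>-fold to the \<open>p\<close>-fold Hilbert space direct sum of copies of the space.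
\<close>

definition tuple_norm :: "('p, 'v) rkhs \<Rightarrow> nat \<Rightarrow> (nat \<Rightarrow> 'v) \<Rightarrow> real" where
  "tuple_norm H n h = sqrt (\<Sum>i<n. (vnorm H (h i))\<^sup>2)"

definition mat_mult_op ::
  "('p, 'v::ab_group_add) rkhs \<Rightarrow> nat \<Rightarrow> ('p \<Rightarrow> nat \<Rightarrow> nat \<Rightarrow> complex) \<Rightarrow> (nat \<Rightarrow> 'v) \<Rightarrow> nat \<Rightarrow> 'v" where
  "mat_mult_op H q \<phi> h i = (\<Sum>j<q. mult_op H (\<lambda>x. \<phi> x i j) (h j))"

definition mat_mult_norm ::
  "('p, 'v::ab_group_add) rkhs \<Rightarrow> nat \<Rightarrow> nat \<Rightarrow> ('p \<Rightarrow> nat \<Rightarrow> nat \<Rightarrow> complex) \<Rightarrow> real" where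
  "mat_mult_norm H p q \<phi> =
     (SUP h\<in>{h. (\<forall>j<q. h j \<in> vecs H) \<and> tuple_norm H q h \<le> 1}. tuple_norm H p (mat_mult_op H q \<phi> h))"

definition complete_pick_property :: "('p, 'v::ab_group_add) rkhs \<Rightarrow> bool" where
  "complete_pick_property H \<longleftrightarrow>
     (\<forall>p q. \<forall>Y \<subseteq> points H. \<forall>\<phi>. mat_mult_norm (subrkhs H Y) p q \<phi> = 1 \<longrightarrow>
        (\<exists>\<phi>'. (\<forall>y\<in>Y. \<forall>i<p. \<forall>j<q. \<phi>' y i j = \<phi> y i j) \<and> mat_mult_norm H p q \<phi>' = 1))"


definition rescaling :: "('p \<Rightarrow> 'q) \<Rightarrow> ('p, 'v) rkhs \<Rightarrow> ('q, 'w) rkhs \<Rightarrow> bool" where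
  "rescaling \<Xi> H H' \<longleftrightarrow>
     bij_betw \<Xi> (points H) (points H') \<and>
     (\<exists>\<gamma>. (\<forall>x\<in>points H. \<gamma> x \<noteq> 0) \<and>
        (\<forall>x\<in>points H. \<forall>y\<in>points H. gram H' (\<Xi> x) (\<Xi> y) = \<gamma> x * cnj (\<gamma> y) * gram H x y))"


definition cdot :: "complex ^ 'n \<Rightarrow> complex ^ 'n \<Rightarrow> complex" where
  "cdot w z = (\<Sum>i\<in>UNIV. w $ i * cnj (z $ i))"

definition DA_kernel :: "complex ^ 'n \<Rightarrow> complex ^ 'n \<Rightarrow> complex" where
  "DA_kernel z = (\<lambda>w. if w \<in> ball 0 1 then 1 / (1 - cdot w z) else 0)"

text \<open>
  For finite \<open>Y\<close> in the unit ball, the subspace of the Drury--Arveson space spanned by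
  the kernels at \<open>Y\<close>.  On this span the inner product is forced by the reproducing property:
  if \<open>g = (\<Sum>y\<in>Y. b y k\<^sub>y)\<close> then \<open>\<langle>f, g\<rangle> = (\<Sum>y\<in>Y. cnj (b y) f(y))\<close>.
\<close>

definition DA :: "(complex ^ 'n) set \<Rightarrow> (complex ^ 'n, complex ^ 'n \<Rightarrow> complex) rkhs" where
  "DA Y = \<lparr>points = Y,
     vscale = (\<lambda>c f w. c * f w),
     ip = (\<lambda>f g. let b = (SOME b. \<forall>w. g w = (\<Sum>y\<in>Y. b y * DA_kernel y w))
                 in \<Sum>y\<in>Y. cnj (b y) * f y),
     kern = DA_kernel\<rparr>"

lemma gram_DA:
  assumes Y: "finite Y" "Y \<subseteq> ball 0 1" and z: "z \<in> Y" and w: "w \<in> Y"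
  shows "gram (DA Y) z w = 1 / (1 - cdot w z)"
proof -
  define P where "P = (\<lambda>b. \<forall>v. DA_kernel w v = (\<Sum>y\<in>Y. b y * DA_kernel y v))"
  have herm: "DA_kernel y u = cnj (DA_kernel u y)" if "y \<in> Y" "u \<in> Y" for y u
  proof -
    have "cdot u y = cnj (cdot y u)" by (simp add: cdot_def mult.commute)
    moreover have "u \<in> ball 0 1" "y \<in> ball 0 1" using that Y(2) by auto
    ultimately show ?thesis by (simp add: DA_kernel_def)
  qed
  have "P (\<lambda>y. if y = w then 1 else 0)"
    using Y(1) w by (simp add: P_def if_distrib[where f = "\<lambda>c. c * _"] cong: if_cong)
  then have "P (SOME b. P b)" by (rule someI[of P])
  then have b: "DA_kernel w z = (\<Sum>y\<in>Y. (SOME b. P b) y * DA_kernel y z)"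
    unfolding P_def by blast
  have "gram (DA Y) z w = (\<Sum>y\<in>Y. cnj ((SOME b. P b) y) * DA_kernel z y)"
    by (simp add: gram_def DA_def P_def Let_def)
  also have "\<dots> = (\<Sum>y\<in>Y. cnj ((SOME b. P b) y * DA_kernel y z))"
  proof (rule sum.cong[OF refl])
    fix y assume "y \<in> Y"
    then have "DA_kernel z y = cnj (DA_kernel y z)" using herm z by blast
    then show "cnj ((SOME b. P b) y) * DA_kernel z y = cnj ((SOME b. P b) y * DA_kernel y z)"
      by (simp only: complex_cnj_mult)
  qed
  also have "\<dots> = cnj (DA_kernel w z)" by (simp only: b cnj_sum)
  also have "\<dots> = 1 / (1 - cdot w z)"
  proof -
    have "w \<in> ball 0 1" using Y(2) w by blast
    then have "DA_kernel z w = 1 / (1 - cdot w z)" by (simp add: DA_kernel_def)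
    then show ?thesis by (simp only: herm[OF z w])
  qed
  finally show ?thesis .
qed

text \<open>Holomorphy in several variables: the real Frechet derivative exists and is complex linear.\<close>

definition holomorphic_map_on :: "(complex ^ 'n \<Rightarrow> complex ^ 'm) \<Rightarrow> (complex ^ 'n) set \<Rightarrow> bool" where
  "holomorphic_map_on f S \<longleftrightarrow>
     (\<forall>z\<in>S. \<exists>f'. (f has_derivative f') (at z) \<and> (\<forall>c v. f' (c *s v) = c *s f' v))"

definition ball_automorphism :: "(complex ^ 'n \<Rightarrow> complex ^ 'n) \<Rightarrow> bool" where
  "ball_automorphism f \<longleftrightarrow>
     bij_betw f (ball 0 1) (ball 0 1) \<and> holomorphic_map_on f (ball 0 1) \<and>
     holomorphic_map_on (inv_into (ball 0 1) f) (ball 0 1)"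

definition congruent_in_ball :: "(complex ^ 'n) list \<Rightarrow> (complex ^ 'n) list \<Rightarrow> bool" where
  "congruent_in_ball zs ws \<longleftrightarrow> (\<exists>f. ball_automorphism f \<and> map f zs = ws)"

definition DA2_model ::
  "('p, 'v) rkhs \<Rightarrow> 'p \<Rightarrow> 'p \<Rightarrow> 'p \<Rightarrow> complex \<Rightarrow> real \<Rightarrow> real \<Rightarrow> ('p \<Rightarrow> complex ^ 2) \<Rightarrow> bool" where
  "DA2_model H x1 x2 x3 w s t \<Phi> \<longleftrightarrow>
     s > 0 \<and> t \<ge> 0 \<and>
     \<Phi> x1 = vector [0, 0] \<and> \<Phi> x2 = vector [complex_of_real s, 0] \<and>
     \<Phi> x3 = vector [w, complex_of_real t] \<and>
     \<Phi> ` points H \<subseteq> ball 0 1 \<and>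
     rescaling \<Phi> H (DA (\<Phi> ` points H))"

text \<open>
  Pairwise linear independence of the kernels needs no separate assumption: the kernels are a basis.
\<close>

definition three_point_rkhs :: "('p, 'v::ab_group_add) rkhs \<Rightarrow> 'p \<Rightarrow> 'p \<Rightarrow> 'p \<Rightarrow> bool" where
  "three_point_rkhs H x1 x2 x3 \<longleftrightarrow>
     fin_rkhs H \<and> points H = {x1, x2, x3} \<and> distinct [x1, x2, x3] \<and>
     (\<forall>x\<in>points H. \<forall>y\<in>points H. gram H x y \<noteq> 0)"

end

theory Submission imports Defs begin

text \<open>
  All six conditions are compared with the inequality
  \<open>|1 - k\<^sub>x\<^sub>z k\<^sub>z\<^sub>y / (k\<^sub>x\<^sub>y k\<^sub>z\<^sub>z)|\<^sup>2 \<le> \<delta>\<^sub>z\<^sub>x\<^sup>2 \<delta>\<^sub>z\<^sub>y\<^sup>2\<close>, which says that the Gram matrix of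
  the kernels, normalised at \<open>z\<close>, has the form \<open>1 / (1 - L)\<close> with \<open>L\<close> positive
  semidefinite; cleared of denominators it is symmetric in the three points.  A factorisation of
  \<open>L\<close> is the same thing as the points of the Drury--Arveson model.  If the inequality holds,
  a contractive matrix multiplier extends by one point: by Parrott's theorem only the part of the
  adjoint orthogonal to the new kernel has to be a contraction, and there the defect form is a Schur
  product with \<open>L\<close>.  Conversely, the Pick property on two points gives \<open>\<delta> = \<delta>\<^sub>G\<close>, and the
  positivity of the \<open>3 \<times> 3\<close> matrix of an extremal multiplier for \<open>\<delta>\<^sub>G\<close>, one of whose
  \<open>2 \<times> 2\<close> minors vanishes, forces the inequality.
\<close>

section \<open>Positive semidefinite forms\<close>

text \<open>A vector is handled through its coefficients on the kernels, so every operator norm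
  becomes an inequality between forms in the Gram matrix. Such forms may be singular, in particular
  the defect form used for the extension; nothing is inverted, and null vectors are controlled by a
  Cauchy-Schwarz argument. Symmetry in the three points is essential. Condition (3) concerns a
  single pair and yields the inequality at one base point, whereas extending a symbol from an
  arbitrary subset needs it at whichever point is added. Starting from one point, \<open>L\<close>
  is a single squared distance and hence positive. The dimension two of the ball comes from
  \<open>L\<close>: beside the base point only two points remain, so \<open>L\<close> is a 2 by 2
  matrix and factors through two coordinates. Its Schur complement is the number
  \<open>t\<^sup>2\<close>, which degenerates to 0 in the case of equality. The Pick properties ask
  for norm exactly one, but an extension never has smaller norm than the symbol that it extends, so
  contractivity suffices. Finally, \<open>delta_G\<close> is only a supremum; compactness of the
  admissible values supplies the extremal multiplier.\<close>

definition qform :: "'a set \<Rightarrow> ('a \<Rightarrow> 'a \<Rightarrow> complex) \<Rightarrow> ('a \<Rightarrow> complex) \<Rightarrow> ('a \<Rightarrow> complex) \<Rightarrow> complex" where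
  "qform I R a b = (\<Sum>x\<in>I. \<Sum>y\<in>I. a x * cnj (b y) * R x y)"

text \<open>Hermitian symmetry is demanded separately: only the real part of the form is bounded
  below, which by itself would allow a skew-Hermitian summand.\<close>

definition psd_on :: "'a set \<Rightarrow> ('a \<Rightarrow> 'a \<Rightarrow> complex) \<Rightarrow> bool" where
  "psd_on I R \<longleftrightarrow> (\<forall>x\<in>I. \<forall>y\<in>I. R y x = cnj (R x y)) \<and> (\<forall>a. 0 \<le> Re (qform I R a a))"

lemma psd_on_herm: "psd_on I R \<Longrightarrow> x \<in> I \<Longrightarrow> y \<in> I \<Longrightarrow> cnj (R x y) = R y x"
  unfolding psd_on_def by metis

lemma psd_on_nonneg: "psd_on I R \<Longrightarrow> 0 \<le> Re (qform I R a a)"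
  by (simp add: psd_on_def)

lemma qform_swap: "qform I R a b = (\<Sum>y\<in>I. cnj (b y) * (\<Sum>x\<in>I. a x * R x y))"
  unfolding qform_def by (subst sum.swap) (simp add: sum_distrib_left mult_ac)

lemma qform_add_left: "qform I R (\<lambda>x. a x + b x) c = qform I R a c + qform I R b c"
  by (simp add: qform_def algebra_simps sum.distrib)

lemma qform_add_right: "qform I R c (\<lambda>x. a x + b x) = qform I R c a + qform I R c b"
  by (simp add: qform_def algebra_simps sum.distrib)

lemma qform_scale_left: "qform I R (\<lambda>x. t * a x) c = t * qform I R a c"
  by (simp add: qform_def sum_distrib_left mult_ac)

lemma qform_scale_right: "qform I R c (\<lambda>x. t * a x) = cnj t * qform I R c a"
  by (simp add: qform_def sum_distrib_left mult_ac)

lemma qform_commute: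
  assumes "psd_on I R"
  shows "qform I R b a = cnj (qform I R a b)"
proof -
  have "cnj (qform I R a b) = (\<Sum>x\<in>I. \<Sum>y\<in>I. cnj (a x) * b y * R y x)"
    using psd_on_herm[OF assms] by (simp add: qform_def)
  also have "\<dots> = qform I R b a"
    unfolding qform_def by (subst sum.swap) (simp add: mult_ac)
  finally show ?thesis by simp
qed

lemma qform_subset:
  assumes "finite I" "S \<subseteq> I"
  shows "qform S R a b = qform I R (\<lambda>x. if x \<in> S then a x else 0) (\<lambda>x. if x \<in> S then b x else 0)"
proof -
  have "qform I R (\<lambda>x. if x \<in> S then a x else 0) (\<lambda>x. if x \<in> S then b x else 0)
      = (\<Sum>x\<in>I. if x \<in> S then \<Sum>y\<in>I. if y \<in> S then a x * cnj (b y) * R x y else 0 else 0)"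
    unfolding qform_def by (intro sum.cong refl) (auto intro!: sum.cong)
  also have "\<dots> = qform S R a b"
    using assms by (simp add: qform_def sum.inter_restrict[symmetric] Int_absorb1)
  finally show ?thesis by simp
qed

lemma psd_on_subset: "psd_on I R \<Longrightarrow> finite I \<Longrightarrow> S \<subseteq> I \<Longrightarrow> psd_on S R"
  unfolding psd_on_def by (metis qform_subset subsetD)

text \<open>The null direction \<open>a\<close> contributes no quadratic term, so the form is
  real-affine along \<open>b + t a\<close>; a nonzero pairing would make it negative for a large
  multiple. This is Cauchy-Schwarz for degenerate forms.\<close>

lemma psd_null:
  assumes "psd_on I R" "qform I R a a = 0"
  shows "qform I R b a = 0"
proof (rule ccontr)
  assume nz: "qform I R b a \<noteq> 0"
  define z where "z = qform I R b a"
  have nz': "0 < (cmod z)\<^sup>2" using nz by (simp add: z_def)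
  obtain n :: nat where n: "Re (qform I R b b) / (2 * (cmod z)\<^sup>2) < real n"
    using reals_Archimedean2 by blast
  define t where "t = - (of_nat n * z)"
  have ab: "qform I R a b = cnj z" unfolding z_def by (rule qform_commute[OF assms(1)])
  have "0 \<le> Re (qform I R (\<lambda>x. b x + t * a x) (\<lambda>x. b x + t * a x))"
    by (rule psd_on_nonneg[OF assms(1)])
  also have "qform I R (\<lambda>x. b x + t * a x) (\<lambda>x. b x + t * a x)
      = qform I R b b + (cnj t * z + t * cnj z)"
    by (simp add: qform_add_left qform_add_right qform_scale_left qform_scale_right assms(2) ab
        flip: z_def)
  also have "cnj t * z + t * cnj z = complex_of_real (- 2 * real n * (cmod z)\<^sup>2)"
    by (simp only: of_real_mult complex_norm_square) (simp add: t_def mult_ac)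
  finally have "2 * real n * (cmod z)\<^sup>2 \<le> Re (qform I R b b)" by simp
  then show False using n nz' by (simp add: field_simps)
qed

text \<open>Existence of an orthogonal projection onto the span of \<open>S\<close>, with
  coefficients \<open>v\<close>, for a possibly singular form. The proof is Gram-Schmidt;
  \<open>w\<close> stays arbitrary in the induction because the hypothesis is applied to
  \<open>w\<close> and to the new index \<open>s\<close>.\<close>

lemma psd_projection:
  assumes "finite S" "psd_on (insert w S) R"
  shows "\<exists>v. \<forall>y\<in>S. R w y = (\<Sum>x\<in>S. v x * R x y)"
  using assms
proof (induction S arbitrary: w rule: finite_induct)
  case empty
  then show ?case by simp
next
  case (insert s S)
  define I where "I = insert w (insert s S)"
  have fI: "finite I" and psd: "psd_on I R" using insert by (auto simp: I_def)
  have "psd_on (insert w S) R" "psd_on (insert s S) R"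
    using psd_on_subset[OF psd fI] by (auto simp: I_def)
  then obtain v u where v: "\<And>y. y \<in> S \<Longrightarrow> R w y = (\<Sum>x\<in>S. v x * R x y)"
    and u: "\<And>y. y \<in> S \<Longrightarrow> R s y = (\<Sum>x\<in>S. u x * R x y)"
    using insert.IH by metis
  \<comment> \<open>\<open>vec t f\<close> is the unit vector at \<open>t\<close> minus the
    combination \<open>f\<close> on \<open>S\<close>; \<open>res t f y\<close> is its product with
    the unit vector at \<open>y\<close>.\<close>
  define res where "res = (\<lambda>t f y. R t y - (\<Sum>x\<in>S. f x * R x y))"
  define vec :: "'a \<Rightarrow> ('a \<Rightarrow> complex) \<Rightarrow> 'a \<Rightarrow> complex"
    where "vec = (\<lambda>t f x. (if x = t then 1 else 0) - (if x \<in> S then f x else 0))"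
  have SI: "S \<subseteq> I" by (auto simp: I_def)
  have vec_sum: "(\<Sum>x\<in>I. vec t f x * R x y) = res t f y" if "t \<in> I" for t f y
    using fI that SI
    by (simp add: vec_def res_def left_diff_distrib sum_subtractf if_distrib[where f = "\<lambda>c. c * _"]
        sum.delta sum.inter_restrict[symmetric] Int_absorb1 cong: if_cong)
  have form: "qform I R (vec t f) (vec s u) = res t f s" if "t \<in> I" "\<And>y. y \<in> S \<Longrightarrow> res t f y = 0" for t f
  proof -
    have "qform I R (vec t f) (vec s u) = (\<Sum>y\<in>I. if y = s then res t f s else 0)"
      unfolding qform_swap vec_sum[OF that(1)] using that(2) insert.hyps(2)
      by (intro sum.cong) (auto simp: vec_def)
    then show ?thesis using fI by (simp add: sum.delta I_def)
  qed
  have rw: "qform I R (vec w v) (vec s u) = res w v s" and rs: "qform I R (vec s u) (vec s u) = res s u s"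
    using form v u by (auto simp: I_def res_def)
  \<comment> \<open>The Gram-Schmidt coefficient. If \<open>s\<close> adds no new direction, the
    denominator vanishes, and by \<open>psd_null\<close> so does the numerator; then 0
    serves.\<close>
  obtain \<beta> where \<beta>: "res w v s = \<beta> * res s u s"
  proof (cases "res s u s = 0")
    case True
    then have "res w v s = 0" using psd_null[OF psd] rw rs by metis
    then show ?thesis using that[of 0] by simp
  next
    case False
    then show ?thesis using that[of "res w v s / res s u s"] by simp
  qed
  \<comment> \<open>The old projection of \<open>w\<close> plus \<open>\<beta>\<close> times the
    residual of \<open>s\<close>.\<close>
  define v' where "v' = (\<lambda>x. if x = s then \<beta> else v x - \<beta> * u x)"
  have sum_v': "(\<Sum>x\<in>insert s S. v' x * R x y)
      = \<beta> * R s y + ((\<Sum>x\<in>S. v x * R x y) - \<beta> * (\<Sum>x\<in>S. u x * R x y))" for y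
  proof -
    have "(\<Sum>x\<in>S. v' x * R x y) = (\<Sum>x\<in>S. v x * R x y - \<beta> * (u x * R x y))"
      using insert.hyps(2) by (intro sum.cong) (auto simp: v'_def algebra_simps)
    then show ?thesis
      using insert.hyps by (simp add: v'_def sum_subtractf sum_distrib_left)
  qed
  have "R w y = (\<Sum>x\<in>insert s S. v' x * R x y)" if "y \<in> insert s S" for y
  proof (cases "y = s")
    case True
    have "R w s = (\<Sum>x\<in>S. v x * R x s) + \<beta> * (R s s - (\<Sum>x\<in>S. u x * R x s))"
      using \<beta> by (simp add: res_def algebra_simps)
    then show ?thesis unfolding sum_v' True by (simp add: algebra_simps)
  next
    case False
    then show ?thesis unfolding sum_v' using that u v by auto
  qed
  then show ?case by blast
qed

lemma qform_insert:
  assumes "finite S" "w \<notin> S"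
  shows "qform (insert w S) R a b = qform S R a b + a w * (\<Sum>y\<in>S. cnj (b y) * R w y)
     + cnj (b w) * (\<Sum>x\<in>S. a x * R x w) + a w * cnj (b w) * R w w"
  using assms by (simp add: qform_def sum.distrib sum_distrib_left algebra_simps)

text \<open>Pythagoras for the projection \<open>v\<close> of \<open>w\<close>. The last bracket is
  the squared distance from \<open>w\<close> to the span of \<open>S\<close>, in other words the
  Schur complement.\<close>

lemma qform_complete_square:
  assumes "finite S" "w \<notin> S" and psd: "psd_on (insert w S) R"
    and v: "\<And>y. y \<in> S \<Longrightarrow> R w y = (\<Sum>x\<in>S. v x * R x y)"
  shows "qform (insert w S) R a a = qform S R (\<lambda>x. a x + a w * v x) (\<lambda>x. a x + a w * v x)
     + complex_of_real ((cmod (a w))\<^sup>2) * (R w w - qform S R v v)"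
proof -
  have psdS: "psd_on S R" using psd_on_subset[OF psd] assms(1) by blast
  have row: "(\<Sum>y\<in>S. cnj (b y) * R w y) = qform S R v b" for b
    unfolding qform_swap using v by simp
  have "(\<Sum>x\<in>S. a x * R x w) = cnj (\<Sum>y\<in>S. cnj (a y) * R w y)"
    using psd_on_herm[OF psd] by simp
  also have "\<dots> = qform S R a v" unfolding row by (rule qform_commute[OF psdS, symmetric])
  finally have col: "(\<Sum>x\<in>S. a x * R x w) = qform S R a v" .
  show ?thesis
    unfolding qform_insert[OF assms(1,2)] row col
    by (simp add: qform_add_left qform_add_right qform_scale_left qform_scale_right
        complex_norm_square algebra_simps del: of_real_power)
qed

section \<open>Extension of functionals dominated by a semidefinite form\<close>

text \<open>
  A Hahn--Banach step for a Hilbert seminorm: compose with the \<open>R\<close>-orthogonal projection.  Used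
  with \<open>R\<close> the defect form of a partially known operator, it is Parrott's theorem.
\<close>

lemma extend_functionals_one:
  assumes "finite S" "w \<notin> S" and psd: "psd_on (insert w S) R"
    and c: "\<And>a. (\<Sum>j\<in>J. (cmod (\<Sum>x\<in>S. c j x * a x))\<^sup>2) \<le> Re (qform S R a a)"
  shows "\<exists>c'. (\<forall>j. \<forall>x\<in>S. c' j x = c j x) \<and>
     (\<forall>a. (\<Sum>j\<in>J. (cmod (\<Sum>x\<in>insert w S. c' j x * a x))\<^sup>2) \<le> Re (qform (insert w S) R a a))"
proof -
  obtain v where v: "\<And>y. y \<in> S \<Longrightarrow> R w y = (\<Sum>x\<in>S. v x * R x y)"
    using psd_projection[OF assms(1) psd] by blast
  note square = qform_complete_square[OF assms(1,2) psd v, simplified]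
  \<comment> \<open>The residual of \<open>w\<close>. Its form value is exactly the Schur
    complement, which is therefore nonnegative.\<close>
  define e where "e = (\<lambda>x. if x = w then 1 else - v x)"
  have "qform S R (\<lambda>x. e x + e w * v x) (\<lambda>x. e x + e w * v x) = 0"
    unfolding qform_def using assms(2) by (intro sum.neutral ballI) (auto simp: e_def)
  moreover have "0 \<le> Re (qform (insert w S) R e e)" by (rule psd_on_nonneg[OF psd])
  ultimately have pos: "0 \<le> Re (R w w - qform S R v v)" using square[of e] by (simp add: e_def)
  \<comment> \<open>At \<open>w\<close> the functional takes its value on the projection
    \<open>v\<close>, so the new sum at \<open>a\<close> is the old one at
    \<open>a + a w * v\<close>.\<close>
  define c' where "c' = (\<lambda>j x. if x = w then \<Sum>x\<in>S. c j x * v x else c j x)"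
  have c'S: "c' j x = c j x" if "x \<in> S" for j x using that assms(2) by (auto simp: c'_def)
  have "(\<Sum>j\<in>J. (cmod (\<Sum>x\<in>insert w S. c' j x * a x))\<^sup>2) \<le> Re (qform (insert w S) R a a)" for a
  proof -
    have "(\<Sum>x\<in>insert w S. c' j x * a x) = (\<Sum>x\<in>S. c j x * (a x + a w * v x))" for j
    proof -
      have "(\<Sum>x\<in>insert w S. c' j x * a x) = c' j w * a w + (\<Sum>x\<in>S. c j x * a x)"
        using assms(1,2) c'S by simp
      then show ?thesis
        by (simp add: c'_def sum_distrib_left sum.distrib algebra_simps)
    qed
    then have "(\<Sum>j\<in>J. (cmod (\<Sum>x\<in>insert w S. c' j x * a x))\<^sup>2)
        \<le> Re (qform S R (\<lambda>x. a x + a w * v x) (\<lambda>x. a x + a w * v x))"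
      using c[of "\<lambda>x. a x + a w * v x"] by simp
    also have "\<dots> \<le> Re (qform (insert w S) R a a)"
      unfolding square[of a]
      using mult_nonneg_nonneg[OF zero_le_power2[of "cmod (a w)"] pos]
      by (simp flip: of_real_power)
    finally show ?thesis .
  qed
  then show ?thesis using c'S by blast
qed

lemma extend_functionals:
  assumes "finite S" "finite T" and psd: "psd_on (S \<union> T) R"
    and c: "\<And>a. (\<Sum>j\<in>J. (cmod (\<Sum>x\<in>S. c j x * a x))\<^sup>2) \<le> Re (qform S R a a)"
  shows "\<exists>c'. (\<forall>j. \<forall>x\<in>S. c' j x = c j x) \<and>
     (\<forall>a. (\<Sum>j\<in>J. (cmod (\<Sum>x\<in>S \<union> T. c' j x * a x))\<^sup>2) \<le> Re (qform (S \<union> T) R a a))"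
  using assms(2) psd
proof (induction T rule: finite_induct)
  case empty
  then show ?case using c by auto
next
  case (insert w T)
  have "psd_on (S \<union> T) R"
    using psd_on_subset[OF insert.prems] insert.hyps assms(1) by auto
  then obtain c1 where c1: "\<And>j x. x \<in> S \<Longrightarrow> c1 j x = c j x"
    "\<And>a. (\<Sum>j\<in>J. (cmod (\<Sum>x\<in>S \<union> T. c1 j x * a x))\<^sup>2) \<le> Re (qform (S \<union> T) R a a)"
    using insert.IH by blast
  show ?case
  proof (cases "w \<in> S \<union> T")
    case True
    then have "S \<union> insert w T = S \<union> T" by auto
    then show ?thesis using c1 by auto
  next
    case False
    have eq: "S \<union> insert w T = insert w (S \<union> T)" by auto
    have fin: "finite (S \<union> T)" using insert.hyps assms(1) by auto
    obtain c2 where "\<And>j x. x \<in> S \<union> T \<Longrightarrow> c2 j x = c1 j x"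
      "\<And>a. (\<Sum>j\<in>J. (cmod (\<Sum>x\<in>insert w (S \<union> T). c2 j x * a x))\<^sup>2)
        \<le> Re (qform (insert w (S \<union> T)) R a a)"
      using extend_functionals_one[OF fin False insert.prems[unfolded eq] c1(2)] by blast
    then show ?thesis using c1(1) unfolding eq by (intro exI[of _ c2]) auto
  qed
qed

section \<open>Adjoints of matrix multipliers and extension by one point\<close>

text \<open>
  The adjoint of the multiplication operator maps \<open>(\<Sum>x. a i x k\<^sub>x)\<close>, \<open>i < p\<close>, to
  \<open>(\<Sum>x. (\<Sum>i. cnj (\<phi> x i j) a i x) k\<^sub>x)\<close>, \<open>j < q\<close>; its norm is expressed here through the
  Gram matrix \<open>G\<close> only.
\<close>

definition adj_coeff :: "nat \<Rightarrow> ('a \<Rightarrow> nat \<Rightarrow> nat \<Rightarrow> complex) \<Rightarrow> (nat \<Rightarrow> 'a \<Rightarrow> complex) \<Rightarrow> nat \<Rightarrow> 'a \<Rightarrow> complex" where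
  "adj_coeff p \<phi> a j x = (\<Sum>i<p. cnj (\<phi> x i j) * a i x)"

definition adj_bound :: "('a \<Rightarrow> 'a \<Rightarrow> complex) \<Rightarrow> 'a set \<Rightarrow> nat \<Rightarrow> nat \<Rightarrow> ('a \<Rightarrow> nat \<Rightarrow> nat \<Rightarrow> complex) \<Rightarrow> real \<Rightarrow> bool" where
  "adj_bound G Y p q \<phi> r \<longleftrightarrow>
     (\<forall>a. (\<Sum>j<q. Re (qform Y G (adj_coeff p \<phi> a j) (adj_coeff p \<phi> a j)))
        \<le> r\<^sup>2 * (\<Sum>i<p. Re (qform Y G (a i) (a i))))"

lemma qform_cong:
  assumes "\<And>x. x \<in> I \<Longrightarrow> a x = a' x" "\<And>x. x \<in> I \<Longrightarrow> b x = b' x"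
    "\<And>x y. x \<in> I \<Longrightarrow> y \<in> I \<Longrightarrow> R x y = R' x y"
  shows "qform I R a b = qform I R' a' b'"
  unfolding qform_def using assms by (intro sum.cong refl) auto

lemma adj_bound_cong:
  assumes "\<And>x i j. x \<in> Y \<Longrightarrow> i < p \<Longrightarrow> j < q \<Longrightarrow> \<phi> x i j = \<phi>' x i j"
  shows "adj_bound G Y p q \<phi> r = adj_bound G Y p q \<phi>' r"
proof -
  have "qform Y G (adj_coeff p \<phi> a j) (adj_coeff p \<phi> a j)
      = qform Y G (adj_coeff p \<phi>' a j) (adj_coeff p \<phi>' a j)" if "j < q" for a j
    using assms that by (intro qform_cong) (auto simp: adj_coeff_def)
  then show ?thesis by (simp add: adj_bound_def)
qed

text \<open>The adjoint acts on the coefficients at each point separately, so the span of the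
  kernels at \<open>Y\<close> is invariant and coefficients can be padded with zeros.\<close>

lemma adj_bound_subset:
  assumes "adj_bound G X p q \<phi> r" "finite X" "Y \<subseteq> X"
  shows "adj_bound G Y p q \<phi> r"
  unfolding adj_bound_def
proof
  fix a :: "nat \<Rightarrow> _ \<Rightarrow> complex"
  define a' where "a' = (\<lambda>i x. if x \<in> Y then a i x else 0)"
  have "adj_coeff p \<phi> a' j = (\<lambda>x. if x \<in> Y then adj_coeff p \<phi> a j x else 0)" for j
    by (auto simp: adj_coeff_def a'_def)
  then show "(\<Sum>j<q. Re (qform Y G (adj_coeff p \<phi> a j) (adj_coeff p \<phi> a j)))
        \<le> r\<^sup>2 * (\<Sum>i<p. Re (qform Y G (a i) (a i)))"
    using assms(1)[unfolded adj_bound_def, rule_format, of a']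
    unfolding qform_subset[OF assms(2,3)] by (simp add: a'_def)
qed

lemma qform_rank_one:
  "qform I (\<lambda>x y. f x * cnj (f y)) a a = complex_of_real ((cmod (\<Sum>x\<in>I. f x * a x))\<^sup>2)"
  unfolding complex_norm_square qform_def
  by (simp add: sum_product mult_ac)

lemma qform_diff_matrix: "qform I (\<lambda>x y. A x y - B x y) a b = qform I A a b - qform I B a b"
  by (simp add: qform_def right_diff_distrib sum_subtractf)

lemma qform_sum_matrix: "qform I (\<lambda>x y. \<Sum>k\<in>K. A k x y) a b = (\<Sum>k\<in>K. qform I (A k) a b)"
  unfolding qform_def sum_distrib_left
  by (subst sum.swap[of _ K]) (intro sum.cong refl sum.swap)

text \<open>Flattening tuples to coefficients on \<open>Z \<times> {..<p}\<close> makes the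
  extension lemma for scalar functionals applicable. The image is measured by a second matrix
  \<open>G'\<close>, so that it can be compressed to the complement of one kernel.\<close>

lemma qform_defect:
  assumes "finite Z"
  shows "qform (Z \<times> {..<p}) (\<lambda>(x, i) (y, i').
      (if i = i' then G x y else 0) - (\<Sum>j<q. cnj (\<phi> x i j) * \<phi> y i' j * G' x y)) a a
    = (\<Sum>i<p. qform Z G (\<lambda>x. a (x, i)) (\<lambda>x. a (x, i)))
    - (\<Sum>j<q. qform Z G' (adj_coeff p \<phi> (\<lambda>i x. a (x, i)) j) (adj_coeff p \<phi> (\<lambda>i x. a (x, i)) j))"
proof -
  have "qform (Z \<times> {..<p}) (\<lambda>(x, i) (y, i'). if i = i' then G x y else 0) a a
     = (\<Sum>x\<in>Z. \<Sum>i<p. \<Sum>y\<in>Z. \<Sum>i'<p. if i' = i then a (x, i) * cnj (a (y, i)) * G x y else 0)"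
    unfolding qform_def sum.cartesian_product'
    by (intro sum.cong refl) auto
  also have "\<dots> = (\<Sum>x\<in>Z. \<Sum>i<p. \<Sum>y\<in>Z. a (x, i) * cnj (a (y, i)) * G x y)"
    by (simp add: sum.delta)
  also have "\<dots> = (\<Sum>i<p. qform Z G (\<lambda>x. a (x, i)) (\<lambda>x. a (x, i)))"
    unfolding qform_def by (rule sum.swap)
  finally have 1: "qform (Z \<times> {..<p}) (\<lambda>(x, i) (y, i'). if i = i' then G x y else 0) a a
     = (\<Sum>i<p. qform Z G (\<lambda>x. a (x, i)) (\<lambda>x. a (x, i)))" .
  have 2: "qform (Z \<times> {..<p}) (\<lambda>(x, i) (y, i'). cnj (\<phi> x i j) * \<phi> y i' j * G' x y) a a
     = qform Z G' (adj_coeff p \<phi> (\<lambda>i x. a (x, i)) j) (adj_coeff p \<phi> (\<lambda>i x. a (x, i)) j)" for j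
  proof -
    have "qform (Z \<times> {..<p}) (\<lambda>(x, i) (y, i'). cnj (\<phi> x i j) * \<phi> y i' j * G' x y) a a
      = (\<Sum>x\<in>Z. \<Sum>i<p. \<Sum>y\<in>Z. \<Sum>i'<p. a (x, i) * cnj (a (y, i')) * (cnj (\<phi> x i j) * \<phi> y i' j * G' x y))"
      unfolding qform_def sum.cartesian_product' by simp
    also have "\<dots> = (\<Sum>x\<in>Z. \<Sum>y\<in>Z. \<Sum>i<p. \<Sum>i'<p. a (x, i) * cnj (a (y, i')) * (cnj (\<phi> x i j) * \<phi> y i' j * G' x y))"
      by (intro sum.cong refl sum.swap)
    also have "\<dots> = qform Z G' (adj_coeff p \<phi> (\<lambda>i x. a (x, i)) j) (adj_coeff p \<phi> (\<lambda>i x. a (x, i)) j)"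
      unfolding qform_def adj_coeff_def
      by (simp add: sum_product sum_distrib_left sum_distrib_right mult_ac)
    finally show ?thesis .
  qed
  have "(\<lambda>(x, i) (y, i'). (if i = i' then G x y else 0) - (\<Sum>j<q. cnj (\<phi> x i j) * \<phi> y i' j * G' x y))
     = (\<lambda>X Y. (case X of (x, i) \<Rightarrow> \<lambda>(y, i'). if i = i' then G x y else 0) Y
         - (\<Sum>j<q. (case X of (x, i) \<Rightarrow> \<lambda>(y, i'). cnj (\<phi> x i j) * \<phi> y i' j * G' x y) Y))"
    by (auto simp: fun_eq_iff)
  then show ?thesis by (simp only: qform_diff_matrix qform_sum_matrix 1 2)
qed

lemma adj_bound_scalar:
  "adj_bound G Y 1 1 (\<lambda>x i j. m x) r \<longleftrightarrow>
    (\<forall>a. Re (qform Y G (\<lambda>x. cnj (m x) * a x) (\<lambda>x. cnj (m x) * a x)) \<le> r\<^sup>2 * Re (qform Y G a a))"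
proof -
  have coeff: "adj_coeff 1 (\<lambda>x i j. m x) a j = (\<lambda>x. cnj (m x) * a 0 x)" for a j
    by (simp add: fun_eq_iff adj_coeff_def)
  have "(\<forall>a::nat \<Rightarrow> 'a \<Rightarrow> complex. P (a 0)) \<longleftrightarrow> (\<forall>a. P a)" for P
  proof
    assume *: "\<forall>a::nat \<Rightarrow> 'a \<Rightarrow> complex. P (a 0)"
    show "\<forall>a. P a" using *[rule_format, of "\<lambda>_. a" for a] by simp
  qed simp
  then show ?thesis unfolding adj_bound_def coeff by simp
qed

lemma qform_scale_matrix:
  "qform I (\<lambda>x y. G x y * (c x * cnj (c y))) a a = qform I G (\<lambda>x. c x * a x) (\<lambda>x. c x * a x)"
  by (simp add: qform_def mult_ac)

lemma adj_coeff_scale: "c x * adj_coeff p \<phi> a j x = adj_coeff p \<phi> (\<lambda>i x. c x * a i x) j x"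
  by (simp add: adj_coeff_def sum_distrib_left mult_ac)

text \<open>
  Adding one point: split off the component along \<open>k\<^sub>z\<close>, the only part of the adjoint that
  the new value \<open>\<phi> z\<close> influences.  The form \<open>G'\<close> on the complement of \<open>k\<^sub>z\<close> is a Schur
  product of \<open>G\<close> with a positive matrix, so the complementary part is a contraction whatever
  \<open>\<phi> z\<close> is, and the remaining part extends by Parrott's theorem.
\<close>

lemma adj_bound_extend:
  fixes G :: "'a \<Rightarrow> 'a \<Rightarrow> complex"
  assumes "finite Y" "z \<notin> Y" and psd: "psd_on (insert z Y) G" and pos: "0 < Re (G z z)"
    and c: "\<And>x y. x \<in> Y \<Longrightarrow> y \<in> Y \<Longrightarrow>
      G x y - G x z * G z y / G z z = G x y * (\<Sum>k\<in>K. c k x * cnj (c k y))"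
    and bound: "adj_bound G Y p q \<phi> 1"
  shows "\<exists>\<phi>'. (\<forall>y\<in>Y. \<phi>' y = \<phi> y) \<and> adj_bound G (insert z Y) p q \<phi>' 1"
proof -
  define Z where "Z = insert z Y"
  have fZ: "finite Z" and YZ: "Y \<subseteq> Z" using assms(1) by (auto simp: Z_def)
  define g where "g = sqrt (Re (G z z))"
  have g: "g > 0" using pos by (simp add: g_def)
  have "cnj (G z z) = G z z" using psd_on_herm[OF psd] by blast
  then have "Im (G z z) = 0" by (metis cnj.simps(2) neg_equal_zero)
  then have Gzz: "G z z = complex_of_real g * complex_of_real g"
    using pos by (simp add: g_def complex_eq_iff flip: of_real_mult)
  have herm: "cnj (G x y) = G y x" if "x \<in> Z" "y \<in> Z" for x y
    using psd_on_herm[OF psd] that by (auto simp: Z_def)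
  \<comment> \<open>\<open>f x\<close> is the coordinate of the kernel at \<open>x\<close> along the
    unit vector in the direction of the kernel at \<open>z\<close>; \<open>G'\<close> is the Gram
    matrix of the projections onto the complement.\<close>
  define f where "f = (\<lambda>x. G x z / complex_of_real g)"
  define G' where "G' = (\<lambda>x y. G x y - f x * cnj (f y))"
  have ff: "f x * cnj (f y) = G x z * G z y / G z z" if "x \<in> Z" "y \<in> Z" for x y
    using herm[OF that(2), of z] by (simp add: f_def Gzz Z_def)
  have fz: "f z = complex_of_real g" using g by (simp add: f_def Gzz)
  have G'z: "G' x z = 0" "G' z x = 0" if "x \<in> Z" for x
    using that ff[of x z] ff[of z x] g by (auto simp: G'_def Gzz Z_def)
  have G'Y: "G' x y = (\<Sum>k\<in>K. G x y * (c k x * cnj (c k y)))" if "x \<in> Y" "y \<in> Y" for x y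
    using c[OF that] ff[OF subsetD[OF YZ that(1)] subsetD[OF YZ that(2)]]
    by (simp add: G'_def sum_distrib_left)
  have split: "qform Z G a a
      = complex_of_real ((cmod (\<Sum>x\<in>Z. f x * a x))\<^sup>2) + qform Z G' a a"
    for a :: "'a \<Rightarrow> complex"
    by (simp only: G'_def qform_diff_matrix qform_rank_one) simp
  have splitY: "qform Y G a a
      = complex_of_real ((cmod (\<Sum>x\<in>Y. f x * a x))\<^sup>2) + qform Y G' a a" for a :: "'a \<Rightarrow> complex"
    by (simp only: G'_def qform_diff_matrix qform_rank_one) simp
  have Z_Y: "qform Z G' a a = qform Y G' a a" for a
    using assms(1,2) G'z unfolding Z_def by (subst qform_insert) (auto simp: Z_def)
  have schur: "qform Y G' a a = (\<Sum>k\<in>K. qform Y G (\<lambda>x. c k x * a x) (\<lambda>x. c k x * a x))" for a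
    unfolding qform_scale_matrix[symmetric] qform_sum_matrix[symmetric]
    using G'Y by (intro qform_cong) auto
  \<comment> \<open>Each term of the Schur product is the original form at coefficients scaled
    pointwise by \<open>c k\<close>. Such scaling commutes with the adjoint, so the bound is
    inherited term by term.\<close>
  have compl: "(\<Sum>j<q. Re (qform Y G' (adj_coeff p \<phi> a j) (adj_coeff p \<phi> a j)))
      \<le> (\<Sum>i<p. Re (qform Y G' (a i) (a i)))" for a
  proof -
    have "(\<Sum>k\<in>K. \<Sum>j<q. Re (qform Y G (adj_coeff p \<phi> (\<lambda>i x. c k x * a i x) j) (adj_coeff p \<phi> (\<lambda>i x. c k x * a i x) j)))
       \<le> (\<Sum>k\<in>K. \<Sum>i<p. Re (qform Y G (\<lambda>x. c k x * a i x) (\<lambda>x. c k x * a i x)))"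
      using bound[unfolded adj_bound_def] by (intro sum_mono) simp
    then show ?thesis
      unfolding schur adj_coeff_scale Re_sum by (simp add: sum.swap[of _ _ K])
  qed

  \<comment> \<open>\<open>R\<close> compares the full norm of the input with the part of the image
    orthogonal to the kernel at \<open>z\<close>. Since \<open>G'\<close> vanishes in row and column
    \<open>z\<close>, the arbitrary value of \<open>\<phi>\<close> at \<open>z\<close> does not
    enter.\<close>
  define R where "R = (\<lambda>(x, i) (y, i').
      (if i = i' then G x y else 0) - (\<Sum>j<q. cnj (\<phi> x i j) * \<phi> y i' j * G' x y))"
  define S T where "S = Y \<times> {..<p}" and "T = {z} \<times> {..<p}"
  have ST: "S \<union> T = Z \<times> {..<p}" by (auto simp: S_def T_def Z_def)
  have fin: "finite S" "finite T" using assms(1) by (auto simp: S_def T_def)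
  have psd_R: "psd_on (S \<union> T) R"
    unfolding psd_on_def
  proof (intro conjI allI ballI)
    fix u v assume "u \<in> S \<union> T" "v \<in> S \<union> T"
    then have "cnj (G (fst u) (fst v)) = G (fst v) (fst u)" using herm unfolding ST by auto
    then show "R v u = cnj (R u v)"
      by (auto simp: R_def G'_def split_beta mult_ac intro!: sum.cong)
  next
    fix a :: "'a \<times> nat \<Rightarrow> complex"
    have "0 \<le> (\<Sum>i<p. (cmod (\<Sum>x\<in>Z. f x * a (x, i)))\<^sup>2)" by (intro sum_nonneg) simp
    also have "\<dots> = Re (qform (S \<union> T) R a a)
       - ((\<Sum>i<p. Re (qform Y G' (\<lambda>x. a (x, i)) (\<lambda>x. a (x, i))))
       - (\<Sum>j<q. Re (qform Y G' (adj_coeff p \<phi> (\<lambda>i x. a (x, i)) j) (adj_coeff p \<phi> (\<lambda>i x. a (x, i)) j))))"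
      unfolding ST R_def qform_defect[OF fZ] split Z_Y
      by (simp add: sum.distrib del: of_real_power)
    finally show "0 \<le> Re (qform (S \<union> T) R a a)" using compl[of "\<lambda>i x. a (x, i)"] by simp
  qed
  \<comment> \<open>\<open>d j\<close> is the coordinate of the \<open>j\<close>-th component of the
    image along the kernel at \<open>z\<close>. The bound on \<open>Y\<close> says exactly that
    these functionals are dominated by \<open>R\<close>.\<close>
  define d where "d = (\<lambda>j (x, i). cnj (\<phi> x i j) * f x)"
  have sum_d: "(\<Sum>u\<in>S. d j u * a u) = (\<Sum>x\<in>Y. f x * adj_coeff p \<phi> (\<lambda>i x. a (x, i)) j x)" for j a
    by (simp add: S_def d_def sum.cartesian_product' adj_coeff_def sum_distrib_left mult_ac)
  have known: "(\<Sum>j<q. (cmod (\<Sum>u\<in>S. d j u * a u))\<^sup>2) \<le> Re (qform S R a a)" for a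
  proof -
    have "(\<Sum>j<q. Re (qform Y G (adj_coeff p \<phi> (\<lambda>i x. a (x, i)) j) (adj_coeff p \<phi> (\<lambda>i x. a (x, i)) j)))
        \<le> (\<Sum>i<p. Re (qform Y G (\<lambda>x. a (x, i)) (\<lambda>x. a (x, i))))"
      using bound[unfolded adj_bound_def, rule_format, of "\<lambda>i x. a (x, i)"] by simp
    then show ?thesis
      unfolding S_def R_def qform_defect[OF assms(1)] sum_d[unfolded S_def]
      unfolding splitY[of "adj_coeff p \<phi> _ _"]
      by (simp add: sum.distrib del: of_real_power)
  qed
  obtain d' where "(\<forall>j. \<forall>u\<in>S. d' j u = d j u) \<and>
      (\<forall>a. (\<Sum>j<q. (cmod (\<Sum>u\<in>S \<union> T. d' j u * a u))\<^sup>2) \<le> Re (qform (S \<union> T) R a a))"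
    by (rule exE[OF extend_functionals[OF fin psd_R known]])
  then have d'S: "\<And>j u. u \<in> S \<Longrightarrow> d' j u = d j u"
    and d': "\<And>a. (\<Sum>j<q. (cmod (\<Sum>u\<in>S \<union> T. d' j u * a u))\<^sup>2) \<le> Re (qform (S \<union> T) R a a)"
    by blast+
  \<comment> \<open>The value at \<open>z\<close> is solved from
    \<open>d' j (z, i) = cnj (\<phi>' z i j) * f z\<close>, where \<open>f z\<close> is the positive
    number \<open>g\<close>.\<close>
  define \<phi>' where "\<phi>' = (\<lambda>x. if x = z then \<lambda>i j. cnj (d' j (z, i) / complex_of_real g) else \<phi> x)"
  have \<phi>'Y: "\<phi>' y = \<phi> y" if "y \<in> Y" for y using that assms(2) by (auto simp: \<phi>'_def)
  have d'\<phi>': "d' j (x, i) = cnj (\<phi>' x i j) * f x" if "x \<in> Z" "i < p" for j x i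
  proof (cases "x = z")
    case True
    then show ?thesis using g by (simp add: \<phi>'_def fz)
  next
    case False
    then have "(x, i) \<in> S" using that by (auto simp: S_def Z_def)
    then show ?thesis using False d'S by (simp add: d_def \<phi>'_def)
  qed
  have "adj_bound G Z p q \<phi>' 1"
    unfolding adj_bound_def
  proof
    fix b :: "nat \<Rightarrow> 'a \<Rightarrow> complex"
    define a where "a = (\<lambda>(x, i). b i x)"
    have coeff: "(\<Sum>u\<in>S \<union> T. d' j u * a u) = (\<Sum>x\<in>Z. f x * adj_coeff p \<phi>' b j x)" for j
      unfolding ST a_def adj_coeff_def
      by (simp add: sum.cartesian_product' d'\<phi>' sum_distrib_left mult_ac)
    have "qform Y G' (adj_coeff p \<phi>' b j) (adj_coeff p \<phi>' b j)
        = qform Y G' (adj_coeff p \<phi> b j) (adj_coeff p \<phi> b j)" for j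
      by (intro qform_cong) (auto simp: adj_coeff_def \<phi>'Y)
    then have "(\<Sum>j<q. Re (qform Z G (adj_coeff p \<phi>' b j) (adj_coeff p \<phi>' b j)))
       = (\<Sum>j<q. (cmod (\<Sum>u\<in>S \<union> T. d' j u * a u))\<^sup>2)
         + (\<Sum>j<q. Re (qform Y G' (adj_coeff p \<phi> b j) (adj_coeff p \<phi> b j)))"
      unfolding split Z_Y coeff by (simp add: sum.distrib del: of_real_power)
    also have "\<dots> \<le> Re (qform (S \<union> T) R a a)
         + (\<Sum>j<q. Re (qform Y G' (adj_coeff p \<phi> b j) (adj_coeff p \<phi> b j)))"
      using d'[of a] by simp
    also have "\<dots> = (\<Sum>i<p. Re (qform Z G (b i) (b i)))"
      unfolding ST R_def qform_defect[OF fZ] by (simp add: a_def Z_Y)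
    finally show "(\<Sum>j<q. Re (qform Z G (adj_coeff p \<phi>' b j) (adj_coeff p \<phi>' b j)))
      \<le> 1\<^sup>2 * (\<Sum>i<p. Re (qform Z G (b i) (b i)))" by simp
  qed
  then show ?thesis using \<phi>'Y unfolding Z_def by blast
qed

section \<open>Multiplier norms and Gram matrices\<close>

context fin_rkhs
begin

section \<open>The span of the kernels as an inner product space\<close>

definition comb :: "('p \<Rightarrow> complex) \<Rightarrow> 'v" where
  "comb a = (\<Sum>x\<in>points H. vscale H (a x) (kern H x))"

lemma vecs_closed:
  shows zero_vecs: "0 \<in> vecs H"
    and add_vecs: "u \<in> vecs H \<Longrightarrow> v \<in> vecs H \<Longrightarrow> u + v \<in> vecs H"
    and diff_vecs: "u \<in> vecs H \<Longrightarrow> v \<in> vecs H \<Longrightarrow> u - v \<in> vecs H"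
    and scale_vecs: "u \<in> vecs H \<Longrightarrow> vscale H c u \<in> vecs H"
    and sum_vecs: "(\<And>i. i \<in> I \<Longrightarrow> f i \<in> vecs H) \<Longrightarrow> sum f I \<in> vecs H"
    and kern_vecs: "x \<in> points H \<Longrightarrow> kern H x \<in> vecs H"
  by (auto simp: vecs_def span_zero span_add span_diff span_scale span_base intro: span_sum)

lemma comb_vecs: "comb a \<in> vecs H"
  unfolding comb_def by (intro sum_vecs scale_vecs kern_vecs)

lemma vecs_comb:
  assumes "h \<in> vecs H"
  obtains a where "h = comb a"
proof -
  have "h \<in> range (\<lambda>u. \<Sum>v\<in>kern H ` points H. vscale H (u v) v)"
    using assms finite_points by (simp add: vecs_def span_finite)
  then obtain u where "h = (\<Sum>v\<in>kern H ` points H. vscale H (u v) v)" by blast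
  then have "h = comb (u \<circ> kern H)" by (simp add: comb_def sum.reindex[OF kern_inj])
  then show ?thesis using that by blast
qed

lemma comb_eq_0:
  assumes "comb a = 0" "x \<in> points H"
  shows "a x = 0"
proof -
  define u where "u = (\<lambda>v. a (inv_into (points H) (kern H) v))"
  have "(\<Sum>v\<in>kern H ` points H. vscale H (u v) v) = comb a"
    unfolding comb_def sum.reindex[OF kern_inj] u_def using kern_inj by (intro sum.cong) auto
  then have "u (kern H x) = 0"
    using independentD[OF kern_independent, of "kern H ` points H" u] assms finite_points by auto
  then show ?thesis using kern_inj assms(2) by (simp add: u_def)
qed

lemma ip_zero_left: "w \<in> vecs H \<Longrightarrow> ip H 0 w = 0"
  using ip_scale_left[of 0 w 0] zero_vecs by simp

lemma ip_add_right: "u \<in> vecs H \<Longrightarrow> v \<in> vecs H \<Longrightarrow> w \<in> vecs H \<Longrightarrow> ip H w (u + v) = ip H w u + ip H w v"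
  using ip_commute add_vecs ip_add_left by (metis complex_cnj_add)

lemma ip_scale_right: "u \<in> vecs H \<Longrightarrow> w \<in> vecs H \<Longrightarrow> ip H w (vscale H c u) = cnj c * ip H w u"
  using ip_commute scale_vecs ip_scale_left by (metis complex_cnj_mult)

lemma ip_sum_left: "(\<And>i. i \<in> I \<Longrightarrow> f i \<in> vecs H) \<Longrightarrow> w \<in> vecs H \<Longrightarrow> ip H (sum f I) w = (\<Sum>i\<in>I. ip H (f i) w)"
  by (induction I rule: infinite_finite_induct)
    (auto simp: ip_zero_left ip_add_left sum_vecs)

lemma ip_zero_right: "w \<in> vecs H \<Longrightarrow> ip H w 0 = 0"
  using ip_scale_right[of 0 w 0] zero_vecs by simp

lemma ip_sum_right: "(\<And>i. i \<in> I \<Longrightarrow> f i \<in> vecs H) \<Longrightarrow> w \<in> vecs H \<Longrightarrow> ip H w (sum f I) = (\<Sum>i\<in>I. ip H w (f i))"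
  by (induction I rule: infinite_finite_induct)
    (auto simp: ip_zero_right ip_add_right sum_vecs)

lemma ip_self_real: "u \<in> vecs H \<Longrightarrow> ip H u u = complex_of_real (Re (ip H u u))"
  using ip_commute[of u u] by (simp add: complex_eq_iff)

lemma ip_self_nonneg: "u \<in> vecs H \<Longrightarrow> 0 \<le> Re (ip H u u)"
  using ip_pos[of u] ip_zero_left[of 0] zero_vecs by (cases "u = 0") auto

lemma ip_comb_right: "h \<in> vecs H \<Longrightarrow> ip H h (comb a) = (\<Sum>x\<in>points H. cnj (a x) * val H h x)"
  by (simp add: comb_def ip_sum_right scale_vecs kern_vecs ip_scale_right val_def)

lemma val_comb: "y \<in> points H \<Longrightarrow> val H (comb a) y = (\<Sum>x\<in>points H. a x * gram H x y)"
  by (simp add: comb_def ip_sum_left scale_vecs kern_vecs ip_scale_left val_def gram_def)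

lemma ip_comb: "ip H (comb a) (comb b) = qform (points H) (gram H) a b"
  by (simp add: ip_comb_right comb_vecs val_comb qform_swap)

lemma gram_herm: "x \<in> points H \<Longrightarrow> y \<in> points H \<Longrightarrow> gram H y x = cnj (gram H x y)"
  unfolding gram_def by (rule ip_commute) (simp_all add: kern_vecs)

lemma psd_gram: "psd_on (points H) (gram H)"
  unfolding psd_on_def
proof (intro conjI ballI allI)
  show "0 \<le> Re (qform (points H) (gram H) a a)" for a
    using ip_self_nonneg[OF comb_vecs, of a] by (simp add: ip_comb)
qed (rule gram_herm)

lemma qform_gram_pos:
  assumes "x \<in> points H" "a x \<noteq> 0"
  shows "0 < Re (qform (points H) (gram H) a a)"
  using ip_pos[OF comb_vecs, of a] comb_eq_0 assms by (auto simp: ip_comb)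

lemma kern_nonzero: "x \<in> points H \<Longrightarrow> kern H x \<noteq> 0"
  using kern_independent dependent_zero by force

lemma gram_pos: "x \<in> points H \<Longrightarrow> 0 < Re (gram H x x)"
  by (simp add: gram_def ip_pos kern_vecs kern_nonzero)

lemma vnorm_nonneg: "u \<in> vecs H \<Longrightarrow> 0 \<le> vnorm H u"
  by (simp add: vnorm_def ip_self_nonneg)

lemma vnorm_square: "u \<in> vecs H \<Longrightarrow> (vnorm H u)\<^sup>2 = Re (ip H u u)"
  by (simp add: vnorm_def ip_self_nonneg)

lemma vnorm_scale: "u \<in> vecs H \<Longrightarrow> vnorm H (vscale H c u) = cmod c * vnorm H u"
proof -
  assume u: "u \<in> vecs H"
  have "ip H (vscale H c u) (vscale H c u) = complex_of_real ((cmod c)\<^sup>2) * ip H u u"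
    unfolding complex_norm_square using u by (simp add: ip_scale_left ip_scale_right scale_vecs)
  then show ?thesis by (simp add: vnorm_def real_sqrt_mult del: of_real_power)
qed

lemma Cauchy_Schwarz:
  assumes u: "u \<in> vecs H" and v: "v \<in> vecs H"
  shows "cmod (ip H u v) \<le> vnorm H u * vnorm H v"
proof (cases "v = 0")
  case True
  then show ?thesis using vnorm_nonneg u v by (simp add: ip_zero_right)
next
  case False
  define N where "N = Re (ip H v v)"
  have N: "N > 0" using ip_pos v False by (simp add: N_def)
  have vv: "ip H v v = complex_of_real N" using ip_self_real[OF v] by (simp add: N_def)
  define z where "z = ip H u v"
  have vu: "ip H v u = cnj z" using ip_commute[OF u v] by (simp add: z_def)
  define s where "s = - z / complex_of_real N"
  have "ip H (u + vscale H s v) (u + vscale H s v)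
      = ip H u u + (cnj s * z + s * cnj z + s * cnj s * complex_of_real N)"
    using u v by (simp add: ip_add_left ip_add_right scale_vecs add_vecs ip_scale_left ip_scale_right vv vu
        algebra_simps flip: z_def)
  also have "cnj s * z + s * cnj z + s * cnj s * complex_of_real N
      = complex_of_real (- ((cmod z)\<^sup>2 / N))"
    unfolding of_real_minus of_real_divide complex_norm_square using N by (simp add: s_def field_simps)
  finally have "0 \<le> Re (ip H u u) - (cmod z)\<^sup>2 / N"
    using ip_self_nonneg[of "u + vscale H s v"] u v by (simp add: add_vecs scale_vecs del: of_real_power)
  then have "(cmod z)\<^sup>2 \<le> (vnorm H u * vnorm H v)\<^sup>2"
    using N by (simp add: power_mult_distrib vnorm_square u v field_simps flip: N_def)
  then show ?thesis
    unfolding z_def by (rule power2_le_imp_le) (simp add: vnorm_nonneg u v)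
qed

lemma vnorm_triangle:
  assumes "u \<in> vecs H" "v \<in> vecs H"
  shows "vnorm H (u + v) \<le> vnorm H u + vnorm H v"
proof (rule power2_le_imp_le)
  have "Re (ip H u v) \<le> vnorm H u * vnorm H v" "Re (ip H v u) \<le> vnorm H u * vnorm H v"
    using Cauchy_Schwarz[OF assms] Cauchy_Schwarz[OF assms(2,1)] complex_Re_le_cmod
    by (metis order_trans, metis order_trans mult.commute)
  then show "(vnorm H (u + v))\<^sup>2 \<le> (vnorm H u + vnorm H v)\<^sup>2"
    using assms by (simp add: power2_sum vnorm_square add_vecs ip_add_left ip_add_right)
  show "0 \<le> vnorm H u + vnorm H v" using assms vnorm_nonneg by simp
qed

lemma vnorm_sum:
  assumes "\<And>i. i \<in> I \<Longrightarrow> f i \<in> vecs H"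
  shows "vnorm H (sum f I) \<le> (\<Sum>i\<in>I. vnorm H (f i))"
  using assms
proof (induction I rule: infinite_finite_induct)
  case (insert x I)
  then show ?case using vnorm_triangle[of "f x" "sum f I"] by (force simp: sum_vecs)
qed (auto simp: vnorm_def ip_zero_left zero_vecs)

section \<open>Point evaluations and multiplication operators\<close>

lemma val_eqI:
  assumes "g \<in> vecs H" "h \<in> vecs H" "\<And>x. x \<in> points H \<Longrightarrow> val H g x = val H h x"
  shows "g = h"
proof (rule ccontr)
  assume "g \<noteq> h"
  have "h + (g - h) = g" by simp
  then have "val H (g - h) x = 0" if "x \<in> points H" for x
    using ip_add_left[of h "g - h" "kern H x"] assms that by (simp add: val_def diff_vecs kern_vecs)
  moreover obtain a where "g - h = comb a" using vecs_comb diff_vecs assms by blast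
  ultimately have "ip H (g - h) (g - h) = 0" by (simp add: ip_comb_right comb_vecs)
  then show False using ip_pos[of "g - h"] assms \<open>g \<noteq> h\<close> by (simp add: diff_vecs)
qed

text \<open>The residual of the kernel at \<open>x\<close> after projection onto the other kernels
  vanishes at the other points. Its value at \<open>x\<close> equals its squared norm, which is
  positive by independence, so it can be normalised.\<close>

lemma dual_vector:
  assumes x: "x \<in> points H"
  shows "\<exists>d\<in>vecs H. \<forall>y\<in>points H. val H d y = (if y = x then 1 else 0)"
proof -
  define S where "S = points H - {x}"
  have S: "finite S" "x \<notin> S" "insert x S = points H" using finite_points x by (auto simp: S_def)
  obtain v where v: "\<And>y. y \<in> S \<Longrightarrow> gram H x y = (\<Sum>t\<in>S. v t * gram H t y)"
    using psd_projection[OF S(1), of x "gram H"] psd_gram S(3) by auto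
  define a where "a = (\<lambda>y. if y = x then 1 else - v y)"
  have "val H (comb a) y = gram H x y - (\<Sum>t\<in>S. v t * gram H t y)" if "y \<in> points H" for y
  proof -
    have "(\<Sum>t\<in>S. a t * gram H t y) = (\<Sum>t\<in>S. - (v t * gram H t y))"
      using S(2) by (intro sum.cong) (auto simp: a_def)
    moreover have "(\<Sum>t\<in>points H. a t * gram H t y) = a x * gram H x y + (\<Sum>t\<in>S. a t * gram H t y)"
      unfolding S(3)[symmetric] by (rule sum.insert[OF S(1,2)])
    ultimately show ?thesis using that by (simp add: val_comb a_def sum_negf)
  qed
  then have zero: "val H (comb a) y = 0" if "y \<in> points H" "y \<noteq> x" for y
    using v that by (simp add: S_def)
  have "ip H (comb a) (comb a) = (\<Sum>y\<in>points H. if y = x then val H (comb a) x else 0)"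
    unfolding ip_comb_right[OF comb_vecs] using zero by (intro sum.cong) (auto simp: a_def)
  also have "\<dots> = val H (comb a) x" using x finite_points by (simp add: sum.delta)
  finally have "val H (comb a) x \<noteq> 0"
    using qform_gram_pos[OF x, of a] by (auto simp: a_def ip_comb)
  then have "\<forall>y\<in>points H. val H (vscale H (1 / val H (comb a) x) (comb a)) y = (if y = x then 1 else 0)"
    using zero by (auto simp: val_def ip_scale_left comb_vecs kern_vecs)
  then show ?thesis using scale_vecs comb_vecs by blast
qed

text \<open>Interpolation by dual vectors, together with \<open>val_eqI\<close>, shows that the
  definite description in \<open>mult_op\<close> always denotes. The family \<open>d\<close> depends
  on neither \<open>h\<close> nor \<open>m\<close>, which the norm estimate exploits.\<close>

lemma mult_op_expansion:
  "\<exists>d. \<forall>h\<in>vecs H. \<forall>m. mult_op H m h \<in> vecs H \<and>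
     (\<forall>x\<in>points H. val H (mult_op H m h) x = m x * val H h x) \<and>
     mult_op H m h = (\<Sum>x\<in>points H. vscale H (m x * val H h x) (d x)) \<and>
     (\<forall>x\<in>points H. d x \<in> vecs H)"
proof -
  obtain d where d: "\<And>x. x \<in> points H \<Longrightarrow> d x \<in> vecs H"
    "\<And>x y. x \<in> points H \<Longrightarrow> y \<in> points H \<Longrightarrow> val H (d x) y = (if y = x then 1 else 0)"
    using dual_vector by metis
  have "mult_op H m h = (\<Sum>x\<in>points H. vscale H (m x * val H h x) (d x)) \<and>
     (\<forall>x\<in>points H. val H (\<Sum>x\<in>points H. vscale H (m x * val H h x) (d x)) x = m x * val H h x)" for m h
  proof -
    define g where "g = (\<Sum>x\<in>points H. vscale H (m x * val H h x) (d x))"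
    have g: "g \<in> vecs H" unfolding g_def using d by (intro sum_vecs scale_vecs)
    have val: "val H g y = m y * val H h y" if "y \<in> points H" for y
    proof -
      have "val H g y = (\<Sum>x\<in>points H. m x * val H h x * val H (d x) y)"
        using d(1) that
        by (simp add: g_def val_def ip_sum_left scale_vecs kern_vecs ip_scale_left)
      also have "\<dots> = (\<Sum>x\<in>points H. if x = y then m y * val H h y else 0)"
        using d(2) that by (intro sum.cong) auto
      finally show ?thesis using that finite_points by simp
    qed
    have "mult_op H m h = g"
      unfolding mult_op_def
    proof (rule the_equality)
      show "g' = g" if "g' \<in> vecs H \<and> (\<forall>x\<in>points H. val H g' x = m x * val H h x)" for g'
        using that g val by (intro val_eqI) auto
    qed (use g val in auto)
    then show ?thesis using val by (simp add: g_def)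
  qed
  moreover have "(\<Sum>x\<in>points H. vscale H (m x * val H h x) (d x)) \<in> vecs H" for m h
    using d by (intro sum_vecs scale_vecs)
  ultimately show ?thesis using d(1) by (intro exI[of _ d]) auto
qed

lemma mult_op_vecs: "h \<in> vecs H \<Longrightarrow> mult_op H m h \<in> vecs H"
  using mult_op_expansion by blast

lemma val_mult_op: "h \<in> vecs H \<Longrightarrow> x \<in> points H \<Longrightarrow> val H (mult_op H m h) x = m x * val H h x"
  using mult_op_expansion by blast

text \<open>Makes the real suprema defining the norms meaningful: on an unbounded set
  \<open>Sup\<close> would be unspecified.\<close>

lemma mult_op_bounded: "\<exists>K\<ge>0. \<forall>h\<in>vecs H. vnorm H (mult_op H m h) \<le> K * vnorm H h"
proof -
  obtain d where d: "\<And>h x. h \<in> vecs H \<Longrightarrow> x \<in> points H \<Longrightarrow> d x \<in> vecs H"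
    "\<And>h. h \<in> vecs H \<Longrightarrow> mult_op H m h = (\<Sum>x\<in>points H. vscale H (m x * val H h x) (d x))"
    using mult_op_expansion by blast
  define K where "K = (\<Sum>x\<in>points H. cmod (m x) * vnorm H (kern H x) * vnorm H (d x))"
  have dv: "d x \<in> vecs H" if "x \<in> points H" for x using d(1)[OF zero_vecs that] .
  have "vnorm H (mult_op H m h) \<le> K * vnorm H h" if h: "h \<in> vecs H" for h
  proof -
    have "vnorm H (mult_op H m h) \<le> (\<Sum>x\<in>points H. vnorm H (vscale H (m x * val H h x) (d x)))"
      unfolding d(2)[OF h] using dv by (intro vnorm_sum scale_vecs)
    also have "\<dots> \<le> (\<Sum>x\<in>points H. cmod (m x) * vnorm H (kern H x) * vnorm H (d x) * vnorm H h)"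
    proof (intro sum_mono)
      fix x assume x: "x \<in> points H"
      have "cmod (val H h x) \<le> vnorm H h * vnorm H (kern H x)"
        unfolding val_def using Cauchy_Schwarz h x by (simp add: kern_vecs)
      then have "cmod (m x) * vnorm H (d x) * cmod (val H h x)
          \<le> cmod (m x) * vnorm H (d x) * (vnorm H h * vnorm H (kern H x))"
        using vnorm_nonneg[OF dv[OF x]] by (intro mult_left_mono) auto
      then show "vnorm H (vscale H (m x * val H h x) (d x))
          \<le> cmod (m x) * vnorm H (kern H x) * vnorm H (d x) * vnorm H h"
        by (simp add: vnorm_scale dv x norm_mult mult_ac)
    qed
    finally show ?thesis by (simp add: K_def sum_distrib_right)
  qed
  moreover have "K \<ge> 0"
    unfolding K_def using dv by (intro sum_nonneg mult_nonneg_nonneg vnorm_nonneg kern_vecs) auto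
  ultimately show ?thesis by blast
qed

lemma mat_mult_op_vecs: "(\<And>j. j < q \<Longrightarrow> h j \<in> vecs H) \<Longrightarrow> mat_mult_op H q \<phi> h i \<in> vecs H"
  unfolding mat_mult_op_def by (intro sum_vecs mult_op_vecs) auto

lemma val_mat_mult_op:
  assumes "\<And>j. j < q \<Longrightarrow> h j \<in> vecs H" "x \<in> points H"
  shows "val H (mat_mult_op H q \<phi> h i) x = (\<Sum>j<q. \<phi> x i j * val H (h j) x)"
proof -
  have "val H (mat_mult_op H q \<phi> h i) x = (\<Sum>j<q. val H (mult_op H (\<lambda>x. \<phi> x i j) (h j)) x)"
    unfolding mat_mult_op_def val_def using assms by (intro ip_sum_left mult_op_vecs kern_vecs) auto
  then show ?thesis using assms by (simp add: val_mult_op)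
qed

lemma mat_mult_op_scale:
  assumes "\<And>j. j < q \<Longrightarrow> h j \<in> vecs H"
  shows "mat_mult_op H q \<phi> (\<lambda>j. vscale H c (h j)) i = vscale H c (mat_mult_op H q \<phi> h i)"
proof (rule val_eqI)
  fix x assume x: "x \<in> points H"
  have "val H (mat_mult_op H q \<phi> (\<lambda>j. vscale H c (h j)) i) x
      = (\<Sum>j<q. \<phi> x i j * val H (vscale H c (h j)) x)"
    using assms x by (intro val_mat_mult_op) (auto intro: scale_vecs)
  also have "\<dots> = c * (\<Sum>j<q. \<phi> x i j * val H (h j) x)"
    using assms x by (simp add: val_def ip_scale_left kern_vecs sum_distrib_left mult_ac)
  also have "\<dots> = c * val H (mat_mult_op H q \<phi> h i) x"
    using assms x by (simp add: val_mat_mult_op)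
  also have "\<dots> = val H (vscale H c (mat_mult_op H q \<phi> h i)) x"
    using assms x by (simp add: val_def ip_scale_left kern_vecs mat_mult_op_vecs)
  finally show "val H (mat_mult_op H q \<phi> (\<lambda>j. vscale H c (h j)) i) x
    = val H (vscale H c (mat_mult_op H q \<phi> h i)) x" .
qed (use assms in \<open>auto intro!: mat_mult_op_vecs scale_vecs\<close>)

lemma mat_mult_op_adjoint:
  assumes "\<And>j. j < q \<Longrightarrow> h j \<in> vecs H"
  shows "(\<Sum>i<p. ip H (mat_mult_op H q \<phi> h i) (comb (a i)))
    = (\<Sum>j<q. ip H (h j) (comb (adj_coeff p \<phi> a j)))"
proof -
  have "(\<Sum>i<p. ip H (mat_mult_op H q \<phi> h i) (comb (a i)))
    = (\<Sum>i<p. \<Sum>x\<in>points H. \<Sum>j<q. cnj (a i x) * \<phi> x i j * val H (h j) x)"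
    using assms by (simp add: ip_comb_right mat_mult_op_vecs val_mat_mult_op sum_distrib_left mult_ac)
  also have "\<dots> = (\<Sum>j<q. \<Sum>i<p. \<Sum>x\<in>points H. cnj (a i x) * \<phi> x i j * val H (h j) x)"
    by (subst sum.swap[of _ "{..<q}"]) (intro sum.cong refl sum.swap)
  also have "\<dots> = (\<Sum>j<q. \<Sum>x\<in>points H. \<Sum>i<p. cnj (a i x) * \<phi> x i j * val H (h j) x)"
    by (intro sum.cong refl sum.swap)
  also have "\<dots> = (\<Sum>j<q. ip H (h j) (comb (adj_coeff p \<phi> a j)))"
    using assms by (simp add: ip_comb_right adj_coeff_def sum_distrib_left mult_ac)
  finally show ?thesis .
qed

section \<open>Tuples of vectors and norms of matrix multipliers\<close>

lemma tuple_norm_L2: "tuple_norm H n h = L2_set (\<lambda>i. vnorm H (h i)) {..<n}"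
  by (simp add: tuple_norm_def L2_set_def)

lemma tuple_norm_nonneg: "0 \<le> tuple_norm H n h"
  by (simp add: tuple_norm_L2)

lemma tuple_norm_square:
  "(\<And>i. i < n \<Longrightarrow> h i \<in> vecs H) \<Longrightarrow> (tuple_norm H n h)\<^sup>2 = (\<Sum>i<n. Re (ip H (h i) (h i)))"
  unfolding tuple_norm_def by (subst real_sqrt_pow2) (auto intro!: sum_nonneg simp: vnorm_square ip_self_nonneg)

lemma tuple_norm_scale:
  assumes "\<And>i. i < n \<Longrightarrow> h i \<in> vecs H" "0 \<le> c"
  shows "tuple_norm H n (\<lambda>i. vscale H (complex_of_real c) (h i)) = c * tuple_norm H n h"
proof -
  have "(\<Sum>i<n. (vnorm H (vscale H (complex_of_real c) (h i)))\<^sup>2) = c\<^sup>2 * (\<Sum>i<n. (vnorm H (h i))\<^sup>2)"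
    using assms by (simp add: vnorm_scale power_mult_distrib sum_distrib_left)
  then show ?thesis using assms(2) by (simp add: tuple_norm_def real_sqrt_mult)
qed

lemma tuple_Cauchy_Schwarz:
  assumes "\<And>i. i < n \<Longrightarrow> g i \<in> vecs H" "\<And>i. i < n \<Longrightarrow> h i \<in> vecs H"
  shows "Re (\<Sum>i<n. ip H (g i) (h i)) \<le> tuple_norm H n g * tuple_norm H n h"
proof -
  have "Re (\<Sum>i<n. ip H (g i) (h i)) \<le> (\<Sum>i<n. \<bar>vnorm H (g i)\<bar> * \<bar>vnorm H (h i)\<bar>)"
    unfolding Re_sum
  proof (intro sum_mono)
    fix i assume "i \<in> {..<n}"
    then have i: "g i \<in> vecs H" "h i \<in> vecs H" using assms by auto
    show "Re (ip H (g i) (h i)) \<le> \<bar>vnorm H (g i)\<bar> * \<bar>vnorm H (h i)\<bar>"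
      using complex_Re_le_cmod[of "ip H (g i) (h i)"] Cauchy_Schwarz[OF i] vnorm_nonneg i by simp
  qed
  then show ?thesis unfolding tuple_norm_L2 by (rule order_trans[OF _ L2_set_mult_ineq])
qed

lemma vnorm_le_tuple_norm: "i < n \<Longrightarrow> h i \<in> vecs H \<Longrightarrow> vnorm H (h i) \<le> tuple_norm H n h"
  unfolding tuple_norm_L2 by (rule member_le_L2_set) auto

lemma bdd_above_mat_mult:
  "bdd_above ((\<lambda>h. tuple_norm H p (mat_mult_op H q \<phi> h)) ` {h. (\<forall>j<q. h j \<in> vecs H) \<and> tuple_norm H q h \<le> 1})"
proof -
  define K where "K = (\<lambda>i j. SOME K. 0 \<le> K \<and>
    (\<forall>h\<in>vecs H. vnorm H (mult_op H (\<lambda>x. \<phi> x i j) h) \<le> K * vnorm H h))"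
  have "0 \<le> K i j \<and> (\<forall>h\<in>vecs H. vnorm H (mult_op H (\<lambda>x. \<phi> x i j) h) \<le> K i j * vnorm H h)" for i j
    unfolding K_def by (rule someI_ex) (use mult_op_bounded in blast)
  then have K: "\<And>i j. 0 \<le> K i j"
    "\<And>i j h. h \<in> vecs H \<Longrightarrow> vnorm H (mult_op H (\<lambda>x. \<phi> x i j) h) \<le> K i j * vnorm H h"
    by blast+
  have "tuple_norm H p (mat_mult_op H q \<phi> h) \<le> (\<Sum>i<p. \<Sum>j<q. K i j)"
    if h: "\<And>j. j < q \<Longrightarrow> h j \<in> vecs H" and le: "tuple_norm H q h \<le> 1" for h
  proof -
    have "vnorm H (mat_mult_op H q \<phi> h i) \<le> (\<Sum>j<q. K i j)" for i
    proof -
      have "vnorm H (mat_mult_op H q \<phi> h i) \<le> (\<Sum>j<q. vnorm H (mult_op H (\<lambda>x. \<phi> x i j) (h j)))"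
        unfolding mat_mult_op_def using h by (intro vnorm_sum mult_op_vecs) auto
      also have "\<dots> \<le> (\<Sum>j<q. K i j)"
      proof (intro sum_mono)
        fix j assume j: "j \<in> {..<q}"
        have "vnorm H (h j) \<le> 1" using vnorm_le_tuple_norm[of j q h] j h le by auto
        then show "vnorm H (mult_op H (\<lambda>x. \<phi> x i j) (h j)) \<le> K i j"
          using K(2)[of "h j" i j] h j K(1)[of i j] mult_left_le[of "vnorm H (h j)" "K i j"] by auto
      qed
      finally show ?thesis .
    qed
    moreover have "tuple_norm H p (mat_mult_op H q \<phi> h) \<le> (\<Sum>i<p. vnorm H (mat_mult_op H q \<phi> h i))"
      unfolding tuple_norm_L2 using h by (intro L2_set_le_sum vnorm_nonneg mat_mult_op_vecs)
    ultimately show ?thesis by (meson order_trans sum_mono)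
  qed
  then show ?thesis by (intro bdd_aboveI[of _ "\<Sum>i<p. \<Sum>j<q. K i j"]) auto
qed

lemma tuple_norm_zero: "tuple_norm H n (\<lambda>_. 0) = 0"
  by (simp add: tuple_norm_def vnorm_def ip_zero_left zero_vecs)

lemma mat_mult_norm_nonneg: "0 \<le> mat_mult_norm H p q \<phi>"
  unfolding mat_mult_norm_def
  by (rule cSUP_upper2[OF bdd_above_mat_mult, of "\<lambda>_. 0"])
    (auto simp: tuple_norm_nonneg tuple_norm_zero zero_vecs)

lemma mat_mult_op_le:
  assumes norm: "mat_mult_norm H p q \<phi> \<le> r" and h: "\<And>j. j < q \<Longrightarrow> h j \<in> vecs H"
  shows "tuple_norm H p (mat_mult_op H q \<phi> h) \<le> r * tuple_norm H q h"
proof (cases "tuple_norm H q h = 0")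
  case True
  \<comment> \<open>A tuple of norm zero stays in the unit ball under any scaling, so its image
    would have norm at most \<open>r\<close> after arbitrary enlargement.\<close>
  have *: "c * tuple_norm H p (mat_mult_op H q \<phi> h) \<le> r" if "0 \<le> c" for c
  proof -
    define h' where "h' = (\<lambda>j. vscale H (complex_of_real c) (h j))"
    have "h' \<in> {h. (\<forall>j<q. h j \<in> vecs H) \<and> tuple_norm H q h \<le> 1}"
      using h that True by (auto simp: h'_def scale_vecs tuple_norm_scale)
    then have "tuple_norm H p (mat_mult_op H q \<phi> h') \<le> r"
      using cSUP_upper[OF _ bdd_above_mat_mult] norm unfolding mat_mult_norm_def by (meson order_trans)
    moreover have "mat_mult_op H q \<phi> h' = (\<lambda>i. vscale H (complex_of_real c) (mat_mult_op H q \<phi> h i))"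
      unfolding h'_def using mat_mult_op_scale h by blast
    ultimately show ?thesis using that h by (simp add: tuple_norm_scale mat_mult_op_vecs)
  qed
  have "tuple_norm H p (mat_mult_op H q \<phi> h) \<le> 0"
  proof (rule ccontr)
    assume "\<not> ?thesis"
    moreover have "0 \<le> r" using mat_mult_norm_nonneg norm order_trans by blast
    ultimately show False
      using *[of "(r + 1) / tuple_norm H p (mat_mult_op H q \<phi> h)"] by simp
  qed
  then show ?thesis using True by simp
next
  case False
  define t where "t = tuple_norm H q h"
  have t: "t > 0" using False tuple_norm_nonneg[of q h] by (simp add: t_def)
  define h' where "h' = (\<lambda>j. vscale H (complex_of_real (1 / t)) (h j))"
  have "tuple_norm H q h' = 1"
    using h t unfolding h'_def by (subst tuple_norm_scale) (auto simp: t_def)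
  then have "h' \<in> {h. (\<forall>j<q. h j \<in> vecs H) \<and> tuple_norm H q h \<le> 1}"
    using h by (auto simp: h'_def scale_vecs)
  then have "tuple_norm H p (mat_mult_op H q \<phi> h') \<le> r"
    using cSUP_upper[OF _ bdd_above_mat_mult] norm unfolding mat_mult_norm_def by (meson order_trans)
  moreover have "mat_mult_op H q \<phi> h' = (\<lambda>i. vscale H (complex_of_real (1 / t)) (mat_mult_op H q \<phi> h i))"
    unfolding h'_def using mat_mult_op_scale h by blast
  moreover have "tuple_norm H p (\<lambda>i. vscale H (complex_of_real (1 / t)) (mat_mult_op H q \<phi> h i))
      = 1 / t * tuple_norm H p (mat_mult_op H q \<phi> h)"
    using t h by (intro tuple_norm_scale mat_mult_op_vecs) auto
  ultimately have "1 / t * tuple_norm H p (mat_mult_op H q \<phi> h) \<le> r" by (simp only:)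
  then show ?thesis using t by (simp add: t_def[symmetric] field_simps)
qed

text \<open>An operator and its adjoint have the same norm, and the adjoint is expressed by the Gram
  matrix alone. Each direction tests on an image: the operator is applied to the adjoint image
  \<open>B a\<close>, and conversely \<open>a\<close> holds the coefficients of the image of
  \<open>h\<close>.\<close>

lemma mat_mult_norm_le_iff:
  assumes r: "0 \<le> r"
  shows "mat_mult_norm H p q \<phi> \<le> r \<longleftrightarrow> adj_bound (gram H) (points H) p q \<phi> r"
proof -
  define A B where "A = (\<lambda>(a :: nat \<Rightarrow> 'p \<Rightarrow> complex) i. comb (a i))"
    and "B = (\<lambda>a j. comb (adj_coeff p \<phi> a j))"
  have AB: "A a i \<in> vecs H" "B a i \<in> vecs H" for a i by (auto simp: A_def B_def comb_vecs)
  have "adj_bound (gram H) (points H) p q \<phi> r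
      \<longleftrightarrow> (\<forall>a. (tuple_norm H q (B a))\<^sup>2 \<le> r\<^sup>2 * (tuple_norm H p (A a))\<^sup>2)"
    unfolding adj_bound_def by (simp add: tuple_norm_square AB) (simp add: A_def B_def ip_comb)
  also have "\<dots> \<longleftrightarrow> (\<forall>a. tuple_norm H q (B a) \<le> r * tuple_norm H p (A a))"
    by (simp add: power_mult_distrib[symmetric] tuple_norm_nonneg r)
  also have "\<dots> \<longleftrightarrow> mat_mult_norm H p q \<phi> \<le> r"
  proof
    assume norm: "mat_mult_norm H p q \<phi> \<le> r"
    show "\<forall>a. tuple_norm H q (B a) \<le> r * tuple_norm H p (A a)"
    proof
      fix a :: "nat \<Rightarrow> 'p \<Rightarrow> complex"
      let ?t = "tuple_norm H q (B a)" and ?s = "tuple_norm H p (A a)"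
      have "?t\<^sup>2 = Re (\<Sum>i<p. ip H (mat_mult_op H q \<phi> (B a) i) (A a i))"
        unfolding A_def by (subst mat_mult_op_adjoint)
          (auto simp: AB tuple_norm_square, simp add: B_def)
      also have "\<dots> \<le> tuple_norm H p (mat_mult_op H q \<phi> (B a)) * ?s"
        by (intro tuple_Cauchy_Schwarz mat_mult_op_vecs AB)
      also have "\<dots> \<le> r * ?t * ?s"
        by (intro mult_right_mono mat_mult_op_le norm AB tuple_norm_nonneg)
      finally have "?t * ?t \<le> (r * ?s) * ?t" by (simp add: power2_eq_square mult_ac)
      then show "?t \<le> r * ?s"
        using tuple_norm_nonneg[of q "B a"] tuple_norm_nonneg[of p "A a"] r
        by (cases "?t = 0") auto
    qed
  next
    assume *: "\<forall>a. tuple_norm H q (B a) \<le> r * tuple_norm H p (A a)"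
    show "mat_mult_norm H p q \<phi> \<le> r"
      unfolding mat_mult_norm_def
    proof (rule cSUP_least)
      have "(\<lambda>_. 0) \<in> {h. (\<forall>j<q. h j \<in> vecs H) \<and> tuple_norm H q h \<le> 1}"
        by (simp add: tuple_norm_zero zero_vecs)
      then show "{h. (\<forall>j<q. h j \<in> vecs H) \<and> tuple_norm H q h \<le> 1} \<noteq> {}"
        by (rule ex_in_conv[THEN iffD1, OF exI])
      fix h assume "h \<in> {h. (\<forall>j<q. h j \<in> vecs H) \<and> tuple_norm H q h \<le> 1}"
      then have h: "\<And>j. j < q \<Longrightarrow> h j \<in> vecs H" and h1: "tuple_norm H q h \<le> 1" by auto
      have "\<exists>b. mat_mult_op H q \<phi> h i = comb b" for i
        by (rule vecs_comb[OF mat_mult_op_vecs[of q h \<phi> i]]) (use h in auto)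
      then obtain a where a: "\<And>i. mat_mult_op H q \<phi> h i = comb (a i)" by metis
      then have eq: "mat_mult_op H q \<phi> h = A a" by (auto simp: A_def)
      let ?s = "tuple_norm H p (A a)"
      have "?s\<^sup>2 = Re (\<Sum>i<p. ip H (mat_mult_op H q \<phi> h i) (comb (a i)))"
        unfolding eq tuple_norm_square[OF AB(1)] by (simp add: A_def)
      also have "\<dots> = Re (\<Sum>j<q. ip H (h j) (B a j))"
        using mat_mult_op_adjoint[OF h] by (simp add: B_def)
      also have "\<dots> \<le> tuple_norm H q h * tuple_norm H q (B a)"
        by (intro tuple_Cauchy_Schwarz h AB)
      also have "\<dots> \<le> 1 * (r * ?s)"
        using * h1 by (intro mult_mono tuple_norm_nonneg) auto
      finally have "?s * ?s \<le> r * ?s" by (simp add: power2_eq_square)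
      then show "tuple_norm H p (mat_mult_op H q \<phi> h) \<le> r"
        unfolding eq using tuple_norm_nonneg[of p "A a"] r by (cases "?s = 0") auto
    qed
  qed
  finally show ?thesis by blast
qed

lemma mult_norm_eq_mat: "mult_norm H m = mat_mult_norm H 1 1 (\<lambda>x i j. m x)"
proof -
  have tn: "tuple_norm H 1 h = vnorm H (h 0)" if "h 0 \<in> vecs H" for h
    using vnorm_nonneg[OF that] by (simp add: tuple_norm_def)
  define S where "S = {h :: nat \<Rightarrow> 'v. (\<forall>j<1. h j \<in> vecs H) \<and> tuple_norm H 1 h \<le> 1}"
  have S: "{h \<in> vecs H. vnorm H h \<le> 1} = (\<lambda>h. h 0) ` S"
  proof (intro equalityI subsetI)
    fix h assume "h \<in> {h \<in> vecs H. vnorm H h \<le> 1}"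
    then have "(\<lambda>_. h) \<in> S" using tn[of "\<lambda>_. h"] by (auto simp: S_def)
    then show "h \<in> (\<lambda>h. h 0) ` S" by (rule rev_image_eqI) simp
  qed (use tn in \<open>auto simp: S_def\<close>)
  have "mult_norm H m = (SUP h\<in>S. vnorm H (mult_op H m (h 0)))"
    unfolding mult_norm_def S by (simp add: image_comp o_def)
  also have "\<dots> = (SUP h\<in>S. tuple_norm H 1 (mat_mult_op H 1 (\<lambda>x i j. m x) h))"
    using tn mult_op_vecs by (intro SUP_cong) (auto simp: S_def mat_mult_op_def)
  finally show ?thesis by (simp add: mat_mult_norm_def S_def)
qed

lemma mult_norm_nonneg: "0 \<le> mult_norm H m"
  unfolding mult_norm_eq_mat by (rule mat_mult_norm_nonneg)

section \<open>Restriction to subsets of the points\<close>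

lemma fin_rkhs_subrkhs:
  assumes "Y \<subseteq> points H"
  shows "fin_rkhs (subrkhs H Y)"
proof -
  have sel: "vscale (subrkhs H Y) = vscale H" "ip (subrkhs H Y) = ip H"
    "kern (subrkhs H Y) = kern H" "points (subrkhs H Y) = Y"
    by (simp_all add: subrkhs_def)
  have sub: "u \<in> vecs H" if "u \<in> vecs (subrkhs H Y)" for u
    using that span_mono[of "kern H ` Y" "kern H ` points H"] assms
    unfolding vecs_def sel by blast
  show ?thesis
    unfolding fin_rkhs_def fin_rkhs_axioms_def sel
  proof (intro conjI allI impI)
    show "vector_space (vscale H)" by (rule vector_space_axioms)
    show "finite Y" using assms finite_points finite_subset by blast
    show "inj_on (kern H) Y" using kern_inj assms inj_on_subset by blast
    show "independent (kern H ` Y)" using kern_independent independent_mono assms by blast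
  qed (rule ip_add_left ip_scale_left ip_commute ip_pos; use sub in blast)+
qed

lemma gram_subrkhs: "gram (subrkhs H Y) = gram H" "points (subrkhs H Y) = Y"
  by (simp_all add: gram_def subrkhs_def fun_eq_iff)

text \<open>Restriction leaves the inner product unchanged, so the multiplier norm on the subspace
  is read off from the \<open>Y\<close> block of the same Gram matrix.\<close>

lemma mat_mult_norm_sub_le_iff:
  "Y \<subseteq> points H \<Longrightarrow> 0 \<le> r \<Longrightarrow>
    mat_mult_norm (subrkhs H Y) p q \<phi> \<le> r \<longleftrightarrow> adj_bound (gram H) Y p q \<phi> r"
  using fin_rkhs.mat_mult_norm_le_iff[OF fin_rkhs_subrkhs] by (simp add: gram_subrkhs)

lemma mult_norm_sub_eq_mat:
  "Y \<subseteq> points H \<Longrightarrow> mult_norm (subrkhs H Y) m = mat_mult_norm (subrkhs H Y) 1 1 (\<lambda>x i j. m x)"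
  using fin_rkhs.mult_norm_eq_mat[OF fin_rkhs_subrkhs] .

text \<open>Supplies the lower bound for extensions: once a symbol of norm one is extended
  contractively, the extension has norm exactly one.\<close>

lemma mat_mult_norm_restrict:
  assumes Y: "Y \<subseteq> points H" and \<phi>: "\<And>y i j. y \<in> Y \<Longrightarrow> i < p \<Longrightarrow> j < q \<Longrightarrow> \<phi>' y i j = \<phi> y i j"
  shows "mat_mult_norm (subrkhs H Y) p q \<phi> \<le> mat_mult_norm H p q \<phi>'"
proof -
  have "adj_bound (gram H) (points H) p q \<phi>' (mat_mult_norm H p q \<phi>')"
    by (simp add: mat_mult_norm_le_iff[symmetric] mat_mult_norm_nonneg)
  then have "adj_bound (gram H) Y p q \<phi>' (mat_mult_norm H p q \<phi>')"
    using adj_bound_subset finite_points Y by blast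
  then have "adj_bound (gram H) Y p q \<phi> (mat_mult_norm H p q \<phi>')"
    using adj_bound_cong[of Y p q \<phi>' \<phi>] \<phi> by blast
  then show ?thesis by (simp add: mat_mult_norm_sub_le_iff Y mat_mult_norm_nonneg)
qed

lemma complete_pick_imp_pick:
  assumes "complete_pick_property H"
  shows "pick_property H"
  unfolding pick_property_def
proof (intro allI impI)
  fix Y m assume Y: "Y \<subseteq> points H" and "mult_norm (subrkhs H Y) m = 1"
  then have "mat_mult_norm (subrkhs H Y) 1 1 (\<lambda>x i j. m x) = 1" by (simp add: mult_norm_sub_eq_mat)
  then obtain \<phi> where \<phi>: "\<forall>y\<in>Y. \<forall>i<1. \<forall>j<1. \<phi> y i j = m y" "mat_mult_norm H 1 1 \<phi> = 1"
    using assms Y unfolding complete_pick_property_def by (metis (no_types, lifting))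
  \<comment> \<open>Only the entry with both indices 0 matters for a 1 by 1 symbol; freezing the
    indices gives a scalar symbol of the same norm.\<close>
  have "mat_mult_norm H 1 1 (\<lambda>x i j. \<phi> x 0 0) \<le> r \<longleftrightarrow> mat_mult_norm H 1 1 \<phi> \<le> r" if "0 \<le> r" for r
    unfolding mat_mult_norm_le_iff[OF that] by (rule adj_bound_cong) simp
  then have "mat_mult_norm H 1 1 (\<lambda>x i j. \<phi> x 0 0) = mat_mult_norm H 1 1 \<phi>"
    using mat_mult_norm_nonneg by (meson order_antisym order_refl)
  then have "mult_norm H (\<lambda>x. \<phi> x 0 0) = 1" using \<phi>(2) by (simp add: mult_norm_eq_mat)
  then show "\<exists>m'. (\<forall>y\<in>Y. m' y = m y) \<and> mult_norm H m' = 1"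
    using \<phi>(1) by (intro exI[of _ "\<lambda>x. \<phi> x 0 0"]) simp
qed

end

section \<open>Two and three points\<close>

text \<open>The entrywise reciprocal of the Gram matrix after the kernels are rescaled so that each
  pairs to one with the kernel at \<open>z\<close>. Thus \<open>1 - base_ratio\<close> is the matrix
  \<open>L\<close>, and unlike the Gram matrix it is invariant under rescaling.\<close>

definition base_ratio :: "('p, 'v) rkhs \<Rightarrow> 'p \<Rightarrow> 'p \<Rightarrow> 'p \<Rightarrow> complex" where
  "base_ratio H z x y = (gram H x z * gram H z y) / (gram H x y * gram H z z)"

lemma qform_pair:
  assumes "x \<noteq> y"
  shows "qform {x, y} R a b = a x * cnj (b x) * R x x + a x * cnj (b y) * R x y
    + a y * cnj (b x) * R y x + a y * cnj (b y) * R y y"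
  using assms by (simp add: qform_def algebra_simps)

context fin_rkhs
begin

lemma gram_self: "x \<in> points H \<Longrightarrow> gram H x x = complex_of_real (Re (gram H x x))"
  using ip_self_real[OF kern_vecs] by (simp add: gram_def)

lemma cmod_gram_commute: "x \<in> points H \<Longrightarrow> y \<in> points H \<Longrightarrow> cmod (gram H y x) = cmod (gram H x y)"
  using gram_herm[of x y] by simp

text \<open>Completing the square in \<open>a y\<close>: the first term carries the squared distance
  from the kernel at \<open>x\<close> to the line spanned by the kernel at \<open>y\<close>.\<close>

lemma qform_pair_square:
  assumes "x \<in> points H" "y \<in> points H" "x \<noteq> y"
  shows "Re (qform {x, y} (gram H) a a)
    = (cmod (a x))\<^sup>2 * (Re (gram H x x) - (cmod (gram H x y))\<^sup>2 / Re (gram H y y))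
    + (cmod (a y * gram H y y + a x * gram H x y))\<^sup>2 / Re (gram H y y)"
proof -
  define A B g where "A = Re (gram H x x)" and "B = Re (gram H y y)" and "g = gram H x y"
  have B: "B > 0" using gram_pos assms by (simp add: B_def)
  have eqs: "gram H x x = complex_of_real A" "gram H y y = complex_of_real B" "gram H y x = cnj g"
    unfolding A_def B_def g_def by (rule gram_self gram_herm; use assms in simp)+
  have "complex_of_real ((cmod (a x))\<^sup>2 * (A - (cmod g)\<^sup>2 / B)
      + (cmod (a y * complex_of_real B + a x * g))\<^sup>2 / B)
    = a x * cnj (a x) * complex_of_real A + a x * cnj (a y) * g + a y * cnj (a x) * cnj g
      + a y * cnj (a y) * complex_of_real B"
    unfolding of_real_add of_real_mult of_real_diff of_real_divide complex_norm_square
    using B by (simp add: field_simps)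
  also have "\<dots> = qform {x, y} (gram H) a a"
    unfolding qform_pair[OF assms(3)] eqs by (simp add: g_def)
  finally show ?thesis unfolding A_def B_def g_def eqs(2)[unfolded B_def, symmetric] by (metis Re_complex_of_real)
qed

lemma cmod_gram_less:
  assumes "x \<in> points H" "y \<in> points H" "x \<noteq> y"
  shows "(cmod (gram H x y))\<^sup>2 < Re (gram H x x) * Re (gram H y y)"
proof -
  define a where "a = (\<lambda>t. if t = x then 1 else - (gram H x y / gram H y y))"
  have B: "Re (gram H y y) > 0" using gram_pos assms by simp
  then have "gram H y y \<noteq> 0" by auto
  then have "a y * gram H y y + a x * gram H x y = 0" using assms(3) by (simp add: a_def)
  then have "Re (qform {x, y} (gram H) a a) = Re (gram H x x) - (cmod (gram H x y))\<^sup>2 / Re (gram H y y)"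
    unfolding qform_pair_square[OF assms] by (simp add: a_def)
  moreover have "0 < Re (qform {x, y} (gram H) a a)"
    using fin_rkhs.qform_gram_pos[OF fin_rkhs_subrkhs[of "{x, y}"], of x a] assms
    by (simp add: gram_subrkhs a_def)
  ultimately have "0 < Re (gram H x x) - (cmod (gram H x y))\<^sup>2 / Re (gram H y y)" by simp
  then show ?thesis using B by (simp add: field_simps)
qed

lemma cmod_ngram_square:
  assumes "x \<in> points H" "y \<in> points H"
  shows "(cmod (ngram H x y))\<^sup>2 = (cmod (gram H x y))\<^sup>2 / (Re (gram H x x) * Re (gram H y y))"
  using gram_pos[OF assms(1)] gram_pos[OF assms(2)]
  by (simp add: ngram_def norm_divide norm_mult power_divide power_mult_distrib)

lemma delta_square:
  assumes "x \<in> points H" "y \<in> points H" "x \<noteq> y"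
  shows "(delta H x y)\<^sup>2 = 1 - (cmod (gram H x y))\<^sup>2 / (Re (gram H x x) * Re (gram H y y))"
    and delta_pos: "0 < delta H x y"
proof -
  have "(cmod (gram H x y))\<^sup>2 / (Re (gram H x x) * Re (gram H y y)) < 1"
    using cmod_gram_less[OF assms] gram_pos assms by simp
  then show "(delta H x y)\<^sup>2 = 1 - (cmod (gram H x y))\<^sup>2 / (Re (gram H x x) * Re (gram H y y))"
    "0 < delta H x y"
    using assms by (simp_all add: delta_def cmod_ngram_square)
qed

lemma delta_commute: "x \<in> points H \<Longrightarrow> y \<in> points H \<Longrightarrow> delta H y x = delta H x y"
  by (simp add: delta_def cmod_ngram_square cmod_gram_commute mult.commute)

lemma delta_le_1: "delta H x y \<le> 1"
  by (simp add: delta_def)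

text \<open>The adjoint kills the kernel at \<open>y\<close> and multiplies the one at
  \<open>x\<close> by \<open>cnj (m x)\<close>. It expands most on the component of the latter
  orthogonal to the former, whose length is \<open>delta H x y\<close> times that of the whole
  kernel.\<close>

lemma two_point_adj_bound:
  assumes xy: "x \<in> points H" "y \<in> points H" "x \<noteq> y" and m: "m y = 0" and r: "0 \<le> r"
  shows "adj_bound (gram H) {x, y} 1 1 (\<lambda>t i j. m t) r \<longleftrightarrow> cmod (m x) \<le> r * delta H x y"
proof -
  define A B d where "A = Re (gram H x x)" and "B = Re (gram H y y)" and "d = delta H x y"
  have pos: "A > 0" "B > 0" "d > 0" using gram_pos delta_pos xy by (auto simp: A_def B_def d_def)
  have Ad: "A - (cmod (gram H x y))\<^sup>2 / B = A * d\<^sup>2"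
    using delta_square[OF xy] pos by (simp add: A_def B_def d_def field_simps)
  have Bne: "gram H y y \<noteq> 0" using pos(2) by (auto simp: B_def)
  have lhs: "Re (qform {x, y} (gram H) (\<lambda>t. cnj (m t) * a t) (\<lambda>t. cnj (m t) * a t))
     = (cmod (m x))\<^sup>2 * ((cmod (a x))\<^sup>2 * A)" for a
  proof -
    have "qform {x, y} (gram H) (\<lambda>t. cnj (m t) * a t) (\<lambda>t. cnj (m t) * a t)
      = complex_of_real ((cmod (m x))\<^sup>2 * ((cmod (a x))\<^sup>2 * A))"
      unfolding of_real_mult complex_norm_square A_def gram_self[OF xy(1), symmetric]
      by (simp add: qform_pair[OF xy(3)] m mult_ac)
    then show ?thesis by simp
  qed
  have rhs: "Re (qform {x, y} (gram H) a a)
    = (cmod (a x))\<^sup>2 * (A * d\<^sup>2) + (cmod (a y * gram H y y + a x * gram H x y))\<^sup>2 / B" for a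
    unfolding qform_pair_square[OF xy] by (simp only: Ad[unfolded A_def B_def] A_def B_def)
  have sq: "cmod (m x) \<le> r * d \<longleftrightarrow> (cmod (m x))\<^sup>2 \<le> r\<^sup>2 * d\<^sup>2"
    using pos r by (simp add: power_mult_distrib[symmetric])
  have "(\<forall>a. (cmod (m x))\<^sup>2 * ((cmod (a x))\<^sup>2 * A)
      \<le> r\<^sup>2 * ((cmod (a x))\<^sup>2 * (A * d\<^sup>2) + (cmod (a y * gram H y y + a x * gram H x y))\<^sup>2 / B))
    \<longleftrightarrow> (cmod (m x))\<^sup>2 \<le> r\<^sup>2 * d\<^sup>2"
  proof
    assume *: "\<forall>a. (cmod (m x))\<^sup>2 * ((cmod (a x))\<^sup>2 * A)
      \<le> r\<^sup>2 * ((cmod (a x))\<^sup>2 * (A * d\<^sup>2) + (cmod (a y * gram H y y + a x * gram H x y))\<^sup>2 / B)"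
    define a where "a = (\<lambda>t. if t = x then 1 else - (gram H x y / gram H y y))"
    have "a y * gram H y y + a x * gram H x y = 0" "a x = 1" using xy(3) Bne by (simp_all add: a_def)
    then have "(cmod (m x))\<^sup>2 * A \<le> (r\<^sup>2 * d\<^sup>2) * A"
      using *[rule_format, of a] by (simp add: mult_ac)
    then show "(cmod (m x))\<^sup>2 \<le> r\<^sup>2 * d\<^sup>2" using pos by auto
  next
    assume *: "(cmod (m x))\<^sup>2 \<le> r\<^sup>2 * d\<^sup>2"
    show "\<forall>a. (cmod (m x))\<^sup>2 * ((cmod (a x))\<^sup>2 * A)
      \<le> r\<^sup>2 * ((cmod (a x))\<^sup>2 * (A * d\<^sup>2) + (cmod (a y * gram H y y + a x * gram H x y))\<^sup>2 / B)"
    proof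
      fix a :: "'p \<Rightarrow> complex"
      have "(cmod (m x))\<^sup>2 * ((cmod (a x))\<^sup>2 * A) \<le> r\<^sup>2 * d\<^sup>2 * ((cmod (a x))\<^sup>2 * A)"
        using * pos by (intro mult_right_mono) auto
      also have "\<dots> \<le> r\<^sup>2 * d\<^sup>2 * ((cmod (a x))\<^sup>2 * A)
          + r\<^sup>2 * ((cmod (a y * gram H y y + a x * gram H x y))\<^sup>2 / B)"
        using pos by simp
      finally show "(cmod (m x))\<^sup>2 * ((cmod (a x))\<^sup>2 * A)
        \<le> r\<^sup>2 * ((cmod (a x))\<^sup>2 * (A * d\<^sup>2) + (cmod (a y * gram H y y + a x * gram H x y))\<^sup>2 / B)"
        by (simp add: algebra_simps)
    qed
  qed
  then show ?thesis
    unfolding adj_bound_scalar lhs rhs d_def[symmetric] sq .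
qed

lemma mult_norm_le_iff: "0 \<le> r \<Longrightarrow> mult_norm H m \<le> r \<longleftrightarrow> adj_bound (gram H) (points H) 1 1 (\<lambda>x i j. m x) r"
  by (simp only: mult_norm_eq_mat mat_mult_norm_le_iff)

lemma adj_bound_value_le:
  assumes "adj_bound (gram H) (points H) 1 1 (\<lambda>x i j. m x) 1"
    "x \<in> points H" "y \<in> points H" "x \<noteq> y" "m y = 0"
  shows "cmod (m x) \<le> delta H x y"
  using adj_bound_subset[OF assms(1) finite_points, of "{x, y}"] two_point_adj_bound[of x y m 1] assms
  by simp

lemma delta_G_le:
  assumes "x \<in> points H" "y \<in> points H" "x \<noteq> y"
  shows "m y = 0 \<Longrightarrow> mult_norm H m \<le> 1 \<Longrightarrow> Re (m x) \<le> delta H x y"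
    and "delta_G H x y \<le> delta H x y"
proof -
  show *: "Re (m x) \<le> delta H x y" if "m y = 0" "mult_norm H m \<le> 1" for m
    using adj_bound_value_le[of m x y] assms that complex_Re_le_cmod[of "m x"]
    by (simp add: mult_norm_le_iff)
  have "mult_norm H (\<lambda>_. 0) \<le> 1"
    unfolding mult_norm_le_iff[OF zero_le_one] adj_bound_scalar
    using psd_on_nonneg[OF psd_gram] by (simp add: qform_def[of _ _ "\<lambda>_. 0"])
  then have "0 \<in> {Re (m x) |m. m y = 0 \<and> mult_norm H m \<le> 1}"
    by (intro CollectI exI[of _ "\<lambda>_. 0"]) simp
  then have "{Re (m x) |m. m y = 0 \<and> mult_norm H m \<le> 1} \<noteq> {}"
    by (rule ex_in_conv[THEN iffD1, OF exI])
  then show "delta_G H x y \<le> delta H x y"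
    unfolding delta_G_def using * by (intro cSup_least) auto
qed

text \<open>The symbol with values \<open>delta H x y\<close> at \<open>x\<close> and 0 at
  \<open>y\<close> has norm exactly one on the pair, and its extension shows that the supremum
  reaches \<open>delta H x y\<close>.\<close>

lemma pick_imp_delta_eq:
  assumes "pick_property H" "x \<in> points H" "y \<in> points H" "x \<noteq> y"
  shows "delta H x y = delta_G H x y"
proof (rule antisym[OF _ delta_G_le(2)[OF assms(2-4)]])
  define m :: "'p \<Rightarrow> complex" where "m = (\<lambda>t. if t = x then complex_of_real (delta H x y) else 0)"
  have d: "delta H x y > 0" using delta_pos assms by simp
  have sub: "{x, y} \<subseteq> points H" using assms by simp
  have "mult_norm (subrkhs H {x, y}) m \<le> r \<longleftrightarrow> 1 \<le> r" if "0 \<le> r" for r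
    unfolding mult_norm_sub_eq_mat[OF sub] mat_mult_norm_sub_le_iff[OF sub that]
    using d assms by (subst two_point_adj_bound) (auto simp: m_def that)
  moreover have "0 \<le> mult_norm (subrkhs H {x, y}) m"
    by (rule fin_rkhs.mult_norm_nonneg[OF fin_rkhs_subrkhs[OF sub]])
  ultimately have "mult_norm (subrkhs H {x, y}) m = 1" by (meson order_antisym order_refl zero_le_one)
  then obtain m' where m': "\<forall>t\<in>{x, y}. m' t = m t" "mult_norm H m' = 1"
    using assms(1) sub unfolding pick_property_def by blast
  have "Re (m' x) \<in> {Re (m x) |m. m y = 0 \<and> mult_norm H m \<le> 1}"
    using m' assms(4) by (auto simp: m_def intro!: exI[of _ m'])
  moreover have "bdd_above {Re (m x) |m. m y = 0 \<and> mult_norm H m \<le> 1}"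
    using delta_G_le(1)[OF assms(2-4)] by (intro bdd_aboveI[of _ "delta H x y"]) auto
  ultimately have "Re (m' x) \<le> delta_G H x y" unfolding delta_G_def by (rule cSup_upper)
  then show "delta H x y \<le> delta_G H x y" using m'(1) by (simp add: m_def)
qed


section \<open>The three-point inequality and its symmetry\<close>

lemma base_ratio_commute:
  assumes "x \<in> points H" "y \<in> points H" "z \<in> points H"
  shows "base_ratio H z y x = cnj (base_ratio H z x y)"
  using assms by (simp add: base_ratio_def flip: gram_herm)

lemma base_ratio_diag:
  assumes "x \<in> points H" "z \<in> points H" "z \<noteq> x"
  shows "base_ratio H z x x = complex_of_real (1 - (delta H z x)\<^sup>2)"
  unfolding base_ratio_def delta_square[OF assms(2,1,3)] of_real_diff of_real_divide of_real_mult
    complex_norm_square gram_self[OF assms(1), symmetric] gram_self[OF assms(2), symmetric]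
  using gram_herm[OF assms(2,1)] by (simp add: mult_ac)

text \<open>The determinant condition for \<open>L\<close> on \<open>{x, y}\<close>. By
  \<open>base_ratio_diag\<close> the diagonal of \<open>L\<close> consists of squared distances,
  which are positive, so this alone decides semidefiniteness.\<close>

definition pick_ineq :: "'p \<Rightarrow> 'p \<Rightarrow> 'p \<Rightarrow> bool" where
  "pick_ineq z x y \<longleftrightarrow> (cmod (1 - base_ratio H z x y))\<^sup>2 \<le> (delta H z x)\<^sup>2 * (delta H z y)\<^sup>2"

text \<open>Multiplying by \<open>p * A * B * C\<^sup>2\<close> removes the special role of
  \<open>z\<close>: both sides of the result are invariant under cyclic rotation of the
  points.\<close>

lemma pick_ineq_iff:
  assumes pts: "x \<in> points H" "y \<in> points H" "z \<in> points H" "z \<noteq> x" "z \<noteq> y"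
    and nz: "gram H x y \<noteq> 0"
  defines "A \<equiv> Re (gram H x x)" and "B \<equiv> Re (gram H y y)" and "C \<equiv> Re (gram H z z)"
    and "p \<equiv> (cmod (gram H x y))\<^sup>2" and "q \<equiv> (cmod (gram H y z))\<^sup>2" and "r \<equiv> (cmod (gram H z x))\<^sup>2"
  shows "pick_ineq z x y \<longleftrightarrow> p * q * A * C + q * r * A * B + r * p * B * C - p * q * r
    \<le> 2 * Re (gram H x y * gram H y z * gram H z x) * A * B * C"
proof -
  define T where "T = gram H x y * gram H y z * gram H z x"
  have pos: "A > 0" "B > 0" "C > 0" using gram_pos pts by (auto simp: A_def B_def C_def)
  have p: "p > 0" using nz by (simp add: p_def)
  have Czz: "gram H z z = complex_of_real C" using gram_self[OF pts(3)] by (simp add: C_def)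
  have herm: "gram H x z = cnj (gram H z x)" "gram H z y = cnj (gram H y z)"
    using gram_herm pts by blast+
  \<comment> \<open>Expanding the fraction by \<open>cnj (gram H x y)\<close> exposes the cyclic
    product \<open>T\<close>.\<close>
  have ratio: "base_ratio H z x y = cnj T / complex_of_real (p * C)"
    using nz pos unfolding base_ratio_def Czz herm T_def p_def of_real_mult complex_norm_square
    by (simp add: field_simps)
  have cT: "(cmod T)\<^sup>2 = p * q * r" by (simp add: T_def p_def q_def r_def norm_mult power_mult_distrib)
  have "(cmod (1 - base_ratio H z x y))\<^sup>2 = 1 - 2 * Re T / (p * C) + (cmod T)\<^sup>2 / (p * C)\<^sup>2"
    unfolding ratio cmod_power2
    by (simp add: power2_eq_square add_divide_distrib algebra_simps)
  also have "\<dots> = 1 - 2 * Re T / (p * C) + q * r / (p * C\<^sup>2)"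
    unfolding cT using p by (simp add: power2_eq_square)
  finally have lhs: "(cmod (1 - base_ratio H z x y))\<^sup>2 = 1 - 2 * Re T / (p * C) + q * r / (p * C\<^sup>2)" .
  have rhs: "(delta H z x)\<^sup>2 * (delta H z y)\<^sup>2 = (1 - r / (C * A)) * (1 - q / (C * B))"
    using pts cmod_gram_commute[of y z]
    by (simp add: delta_square A_def B_def C_def q_def r_def)
  have "pick_ineq z x y \<longleftrightarrow> p * A * B * C\<^sup>2 * (1 - 2 * Re T / (p * C) + q * r / (p * C\<^sup>2))
      \<le> p * A * B * C\<^sup>2 * ((1 - r / (C * A)) * (1 - q / (C * B)))"
    unfolding pick_ineq_def lhs rhs using pos p by (intro mult_le_cancel_left_pos[symmetric]) simp
  also have "p * A * B * C\<^sup>2 * (1 - 2 * Re T / (p * C) + q * r / (p * C\<^sup>2))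
      = p * A * B * C\<^sup>2 - 2 * Re T * A * B * C + q * r * A * B"
    using pos p by (simp add: field_simps power2_eq_square)
  also have "p * A * B * C\<^sup>2 * ((1 - r / (C * A)) * (1 - q / (C * B)))
      = p * A * B * C\<^sup>2 - p * r * B * C - p * q * A * C + p * q * r"
    using pos p by (simp add: field_simps power2_eq_square)
  finally show ?thesis unfolding T_def by (simp add: algebra_simps)
qed

lemma pick_ineq_commute:
  assumes "x \<in> points H" "y \<in> points H" "z \<in> points H"
  shows "pick_ineq z x y = pick_ineq z y x"
proof -
  have "1 - base_ratio H z y x = cnj (1 - base_ratio H z x y)"
    by (simp add: base_ratio_commute[OF assms])
  then show ?thesis unfolding pick_ineq_def by (metis complex_mod_cnj mult.commute)
qed

lemma pick_ineq_rotate: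
  assumes "x \<in> points H" "y \<in> points H" "z \<in> points H" "distinct [x, y, z]"
    and "gram H x y \<noteq> 0" "gram H y z \<noteq> 0"
  shows "pick_ineq z x y = pick_ineq x y z"
proof -
  have ne: "z \<noteq> x" "z \<noteq> y" "x \<noteq> y" "x \<noteq> z" using assms(4) by auto
  have T: "gram H y z * gram H z x * gram H x y = gram H x y * gram H y z * gram H z x"
    by (simp only: mult_ac)
  show ?thesis
    unfolding pick_ineq_iff[OF assms(1-3) ne(1,2) assms(5)] pick_ineq_iff[OF assms(2,3,1) ne(3,4) assms(6)] T
    by (simp only: mult_ac add_ac)
qed

text \<open>This is the symmetric polynomial inequality divided by \<open>p * q * r\<close>, the
  cosine of the angle being \<open>Re T / cmod T\<close>.\<close>

lemma pick_ineq_iff_cos_angle: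
  assumes pts: "x \<in> points H" "y \<in> points H" "z \<in> points H" "distinct [x, y, z]"
    and nz: "gram H x y \<noteq> 0" "gram H y z \<noteq> 0" "gram H x z \<noteq> 0"
  shows "pick_ineq x y z \<longleftrightarrow>
    1 / (cmod (ngram H x y))\<^sup>2 + 1 / (cmod (ngram H y z))\<^sup>2 + 1 / (cmod (ngram H x z))\<^sup>2 - 1
      \<le> 2 * cos (angle H x y z) / (cmod (ngram H x y) * cmod (ngram H y z) * cmod (ngram H x z))"
proof -
  define A B C where "A = Re (gram H x x)" and "B = Re (gram H y y)" and "C = Re (gram H z z)"
  define p q r where "p = (cmod (gram H x y))\<^sup>2" and "q = (cmod (gram H y z))\<^sup>2" and "r = (cmod (gram H z x))\<^sup>2"
  define T where "T = gram H x y * gram H y z * gram H z x"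
  have pos: "A > 0" "B > 0" "C > 0" using gram_pos pts by (auto simp: A_def B_def C_def)
  have nzx: "gram H z x \<noteq> 0" using nz(3) gram_herm[of x z] pts by simp
  have pos': "p > 0" "q > 0" "r > 0" using nz nzx by (auto simp: p_def q_def r_def)
  have pqr: "0 < p * q * r" using pos' by simp
  have T0: "T \<noteq> 0" using nz nzx by (simp add: T_def)
  have n: "(cmod (ngram H x y))\<^sup>2 = p / (A * B)" "(cmod (ngram H y z))\<^sup>2 = q / (B * C)"
    "(cmod (ngram H x z))\<^sup>2 = r / (A * C)"
    using cmod_ngram_square cmod_gram_commute[of x z] pts
    by (simp_all add: A_def B_def C_def p_def q_def r_def)
  define N where "N = cmod (ngram H x y) * cmod (ngram H y z) * cmod (ngram H x z)"
  \<comment> \<open>Every point occurs in two of the three normalised kernels, so the square roots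
    combine to \<open>A * B * C\<close>.\<close>
  have "N * (A * B * C) = cmod T"
  proof (rule power2_eq_imp_eq)
    have "(N * (A * B * C))\<^sup>2 = p / (A * B) * (q / (B * C)) * (r / (A * C)) * (A * B * C)\<^sup>2"
      unfolding N_def power_mult_distrib n ..
    also have "\<dots> = p * q * r" using pos by (simp add: field_simps power2_eq_square)
    also have "\<dots> = (cmod T)\<^sup>2" by (simp add: T_def p_def q_def r_def norm_mult power_mult_distrib)
    finally show "(N * (A * B * C))\<^sup>2 = (cmod T)\<^sup>2" .
  qed (use pos in \<open>simp_all add: N_def\<close>)
  then have N: "N = cmod T / (A * B * C)" using pos by (simp add: field_simps)
  have "2 * cos (angle H x y z) / N = 2 * Re T * A * B * C / (cmod T)\<^sup>2"
    using T0 pos unfolding N angle_def T_def[symmetric]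
    by (simp add: cos_Arg field_simps power2_eq_square)
  also have "(cmod T)\<^sup>2 = p * q * r"
    by (simp add: T_def p_def q_def r_def norm_mult power_mult_distrib)
  finally have rhs: "2 * cos (angle H x y z) / N = 2 * Re T * A * B * C / (p * q * r)" .
  have lhs: "1 / (p / (A * B)) + 1 / (q / (B * C)) + 1 / (r / (A * C)) - 1
     = (q * r * A * B + r * p * B * C + p * q * A * C - p * q * r) / (p * q * r)"
    using pos' by (simp add: field_simps)
  have "pick_ineq x y z = pick_ineq z x y" using pick_ineq_rotate[of x y z] pts nz by simp
  also have "\<dots> \<longleftrightarrow> q * r * A * B + r * p * B * C + p * q * A * C - p * q * r \<le> 2 * Re T * A * B * C"
    using pick_ineq_iff[of x y z] pts nz pts(4)[THEN distinct_rev[THEN iffD2]]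
    by (simp add: A_def B_def C_def p_def q_def r_def T_def add_ac)
  also have "\<dots> \<longleftrightarrow> (q * r * A * B + r * p * B * C + p * q * A * C - p * q * r) / (p * q * r)
     \<le> 2 * Re T * A * B * C / (p * q * r)"
    using pqr order_less_not_sym[OF pqr] by (simp only: divide_le_cancel simp_thms)
  finally show ?thesis unfolding n rhs[unfolded N_def] lhs .
qed

section \<open>Extremal multipliers and extension from subsets\<close>

text \<open>
  An extremal multiplier for \<open>\<delta>\<^sub>G\<close> makes a \<open>2 \<times> 2\<close> minor of the positive
  matrix \<open>(1 - cnj m\<^sub>i m\<^sub>j) k\<^sub>i\<^sub>j\<close> singular; its null vector determines the remaining value of \<open>m\<close>.
\<close>

lemma delta_eq_imp_pick_ineq:
  assumes pts: "points H = {x, y, z}" and dist: "distinct [x, y, z]"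
    and nz: "gram H z x \<noteq> 0" and eq: "delta H x y = delta_G H x y"
  shows "pick_ineq y z x"
proof -
  have P: "x \<in> points H" "y \<in> points H" "z \<in> points H" using pts by auto
  \<comment> \<open>On the point set, a multiplier vanishing at \<open>y\<close> is a pair of values
    at \<open>x\<close> and \<open>z\<close>. In this form the contractive ones make up a compact
    set \<open>K\<close>, so the supremum defining \<open>delta_G\<close> is attained.\<close>
  define e where "e = (\<lambda>(a::'p) t. if t = a then 1 else 0 :: complex)"
  define sym where "sym = (\<lambda>(w :: complex \<times> complex) t. e x t * fst w + e z t * snd w)"
  define K where "K = {w. adj_bound (gram H) (points H) 1 1 (\<lambda>t i j. sym w t) 1}"
  have sym_simps: "sym w x = fst w" "sym w y = 0" "sym w z = snd w" for w
    using dist by (auto simp: sym_def e_def)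
  have "closed K"
    unfolding K_def adj_bound_scalar qform_def sym_def
    by (intro closed_Collect_all closed_Collect_le continuous_intros)
  moreover have bound: "cmod (fst w) \<le> delta H x y" "cmod (snd w) \<le> delta H z y" if "w \<in> K" for w
    using that adj_bound_value_le[of "sym w" x y] adj_bound_value_le[of "sym w" z y] P dist
    by (auto simp: K_def sym_simps)
  have "K \<subseteq> cball 0 1 \<times> cball 0 1"
  proof
    fix w assume "w \<in> K"
    then show "w \<in> cball 0 1 \<times> cball 0 1"
      using bound[of w] delta_le_1[of x y] delta_le_1[of z y] by (cases w) auto
  qed
  then have "bounded K" using bounded_Times[OF bounded_cball bounded_cball] bounded_subset by blast
  ultimately have "compact K" by (simp add: compact_eq_bounded_closed)
  moreover have "sym (0, 0) = (\<lambda>_. 0)" by (auto simp: sym_def)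
  then have "(0, 0) \<in> K"
    unfolding K_def mem_Collect_eq adj_bound_scalar
    using psd_on_nonneg[OF psd_gram] by (simp add: qform_def[of _ _ "\<lambda>_. 0"])
  then have "K \<noteq> {}" by blast
  moreover have "continuous_on K (\<lambda>w. Re (fst w))" by (intro continuous_intros)
  ultimately obtain w where w: "w \<in> K" and max: "\<And>w'. w' \<in> K \<Longrightarrow> Re (fst w') \<le> Re (fst w)"
    using continuous_attains_sup by metis
  define u v where "u = fst w" and "v = snd w"
  have "delta_G H x y = Re u"
    unfolding delta_G_def
  proof (rule cSup_eq_maximum)
    have "mult_norm H (sym w) \<le> 1" using w by (simp add: K_def mult_norm_le_iff)
    then show "Re u \<in> {Re (m x) |m. m y = 0 \<and> mult_norm H m \<le> 1}"
      by (intro CollectI exI[of _ "sym w"]) (simp add: sym_simps u_def)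
    fix s assume "s \<in> {Re (m x) |m. m y = 0 \<and> mult_norm H m \<le> 1}"
    then obtain m where m: "s = Re (m x)" "m y = 0" "mult_norm H m \<le> 1" by blast
    have "adj_bound (gram H) (points H) 1 1 (\<lambda>t i j. m t) 1" using m by (simp add: mult_norm_le_iff)
    moreover have "sym (m x, m z) t = m t" if "t \<in> points H" for t
      using that m(2) sym_simps pts by auto
    ultimately have "adj_bound (gram H) (points H) 1 1 (\<lambda>t i j. sym (m x, m z) t) 1"
      using adj_bound_cong[of "points H" 1 1 "\<lambda>t i j. m t" "\<lambda>t i j. sym (m x, m z) t"] by simp
    then have "(m x, m z) \<in> K" by (simp add: K_def)
    then show "s \<le> Re u" using max m(1) by (force simp: u_def)
  qed
  then have Re_u: "Re u = delta H x y" using eq by simp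
  \<comment> \<open>The real part already equals the bound \<open>delta H x y\<close> on the
    modulus, so the extremal value is real.\<close>
  have "cmod u \<le> Re u" using bound(1)[OF w] Re_u by (simp add: u_def)
  then have "Im u = 0" using cmod_eq_Re complex_Re_le_cmod[of u]
    by (metis abs_Re_le_cmod abs_le_D1 add_cancel_left_right cmod_power2 order_antisym power_eq_0_iff)
  then have u: "u = complex_of_real (delta H x y)" using Re_u by (simp add: complex_eq_iff)
  define m where "m = sym w"
  have m: "m x = complex_of_real (delta H x y)" "m y = 0" "m z = v"
    using u sym_simps by (auto simp: m_def u_def v_def)
  define R where "R = (\<lambda>s t. gram H s t - cnj (m s) * m t * gram H s t)"
  have R_form: "qform (points H) R a a = qform (points H) (gram H) a a
      - qform (points H) (gram H) (\<lambda>t. cnj (m t) * a t) (\<lambda>t. cnj (m t) * a t)" for a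
    by (simp add: R_def qform_def right_diff_distrib sum_subtractf mult_ac)
  have psd: "psd_on (points H) R"
    unfolding psd_on_def
  proof (intro conjI ballI allI)
    fix s t assume "s \<in> points H" "t \<in> points H"
    then have "gram H t s = cnj (gram H s t)" by (rule gram_herm)
    then show "R t s = cnj (R s t)" by (simp add: R_def mult_ac)
  next
    fix a
    show "0 \<le> Re (qform (points H) R a a)"
      using w unfolding R_form K_def mem_Collect_eq adj_bound_scalar m_def by simp
  qed
  define A B where "A = Re (gram H x x)" and "B = Re (gram H y y)"
  have AB: "A > 0" "B > 0" using gram_pos P by (auto simp: A_def B_def)
  have gx: "gram H x x = complex_of_real A" unfolding A_def by (rule gram_self[OF P(1)])
  have gy: "gram H y y = complex_of_real B" unfolding B_def by (rule gram_self[OF P(2)])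
  have gyx: "gram H y x = cnj (gram H x y)" by (rule gram_herm[OF P(1,2)])
  \<comment> \<open>\<open>f\<close> is the null vector of the \<open>{x, y}\<close> block of
    \<open>R\<close>. As \<open>m y = 0\<close>, row and column \<open>y\<close> are those of the
    Gram matrix, while \<open>R x x\<close> has dropped to the value that gives the block rank
    one.\<close>
  define c where "c = gram H x y / gram H y y"
  define f where "f = (\<lambda>t. e x t - c * e y t)"
  have fs: "f x = 1" "f y = - c" "f z = 0" using dist by (auto simp: f_def e_def)
  have R: "R s y = gram H s y" "R y s = gram H y s" for s by (simp_all add: R_def m)
  have "complex_of_real ((delta H x y)\<^sup>2) = 1 - gram H x y * cnj (gram H x y) / (complex_of_real A * complex_of_real B)"
    using delta_square[OF P(1,2)] dist unfolding A_def B_def complex_norm_square[symmetric] by simp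
  then have Rxx: "R x x = gram H x y * gram H y x / gram H y y"
    using AB by (simp add: R_def m gx gy gyx field_simps power2_eq_square)
  have null: "qform (points H) R b f = (\<Sum>s\<in>points H. b s * (R s x - cnj c * R s y))" for b
    unfolding qform_def pts using dist fs by (simp add: algebra_simps)
  have cc: "cnj c = gram H y x / gram H y y" unfolding c_def gyx gy by simp
  have "qform (points H) R f f = 0"
    unfolding null unfolding pts using dist fs AB by (simp add: Rxx R cc gy gyx c_def)
  \<comment> \<open>Orthogonality of the null vector to the third point determines
    \<open>R z x\<close>, and with it \<open>m z\<close>, from the kernels.\<close>
  then have "qform (points H) R (e z) f = 0" by (rule psd_null[OF psd])
  then have "R z x = gram H y x * gram H z y / gram H y y"
    unfolding null unfolding pts using dist by (simp add: e_def R cc)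
  then have "gram H z x * (1 - cnj v * complex_of_real (delta H x y)) = gram H z y * gram H y x / gram H y y"
    by (simp add: R_def m algebra_simps)
  moreover have "base_ratio H y z x = gram H z y * gram H y x / gram H y y / gram H z x"
    by (simp add: base_ratio_def)
  ultimately have "base_ratio H y z x = 1 - cnj v * complex_of_real (delta H x y)"
    using nz by (metis nonzero_mult_div_cancel_left)
  then have "(cmod (1 - base_ratio H y z x))\<^sup>2 = (cmod v)\<^sup>2 * (delta H x y)\<^sup>2"
    by (simp add: norm_mult power_mult_distrib)
  also have "\<dots> \<le> (delta H z y)\<^sup>2 * (delta H x y)\<^sup>2"
    using bound(2)[OF w] by (intro mult_right_mono power_mono) (auto simp: v_def)
  finally show ?thesis
    unfolding pick_ineq_def using delta_commute P by simp
qed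

text \<open>At most two points lie beside \<open>z\<close>, so a Cholesky factorisation of
  \<open>L\<close> on \<open>Y\<close> can be written down, with \<open>pick_ineq\<close> as its
  determinant condition. On a one-point \<open>Y\<close>, \<open>L\<close> is a squared
  distance.\<close>

lemma kernel_factor:
  assumes pts: "points H \<subseteq> {x1, x2, x3}" "Y \<subseteq> points H" "z \<in> points H - Y" "Y \<noteq> {}"
    and nz: "\<And>x y. x \<in> points H \<Longrightarrow> y \<in> points H \<Longrightarrow> gram H x y \<noteq> 0"
    and ineq: "\<And>x y z. x \<in> points H \<Longrightarrow> y \<in> points H \<Longrightarrow> z \<in> points H \<Longrightarrow> distinct [x, y, z] \<Longrightarrow> pick_ineq z x y"
  shows "\<exists>c :: nat \<Rightarrow> 'p \<Rightarrow> complex. \<forall>x\<in>Y. \<forall>y\<in>Y.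
    gram H x y - gram H x z * gram H z y / gram H z z
      = gram H x y * (\<Sum>k\<in>{0, 1}. c k x * cnj (c k y))"
proof -
  have entry: "gram H x y - gram H x z * gram H z y / gram H z z = gram H x y * (1 - base_ratio H z x y)"
    if "x \<in> Y" "y \<in> Y" for x y
    using nz[of x y] that pts by (auto simp: base_ratio_def right_diff_distrib)
  have diag: "1 - base_ratio H z x x = complex_of_real ((delta H z x)\<^sup>2)" if "x \<in> Y" for x
  proof -
    have "x \<in> points H" "z \<in> points H" "z \<noteq> x" using that pts by auto
    then show ?thesis using base_ratio_diag[of x z] by simp
  qed
  \<comment> \<open>Equality of \<open>x\<close> and \<open>y\<close> is allowed and covers
    singletons.\<close>
  obtain x y where Y: "Y = {x, y}"
  proof -
    have "Y \<subseteq> {x1, x2, x3} - {z}" "z \<in> {x1, x2, x3}" using pts by auto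
    then obtain a b where "Y \<subseteq> {a, b}" by auto
    then have "Y = {a, a} \<or> Y = {b, b} \<or> Y = {a, b}" using pts(4) by auto
    then show ?thesis using that by blast
  qed
  have xy: "x \<in> points H" "y \<in> points H" "z \<in> points H" "z \<noteq> x" "z \<noteq> y" using pts Y by auto
  define L where "L = 1 - base_ratio H z x y"
  define d where "d = delta H z x"
  have d: "d > 0" using delta_pos xy by (simp add: d_def)
  have Lyx: "1 - base_ratio H z y x = cnj L"
    by (simp add: L_def base_ratio_commute[OF xy(1-3)])
  define s where "s = (delta H z y)\<^sup>2 - (cmod L)\<^sup>2 / d\<^sup>2"
  have s: "0 \<le> s"
  proof (cases "x = y")
    case True
    then have "L = complex_of_real (d\<^sup>2)" using diag[of x] Y by (simp add: L_def d_def)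
    then have "cmod L = d\<^sup>2" using d by (simp add: norm_power)
    then show ?thesis using True d by (simp add: s_def d_def power2_eq_square)
  next
    case False
    then have "(cmod L)\<^sup>2 \<le> d\<^sup>2 * (delta H z y)\<^sup>2"
      using ineq[of x y z] xy by (simp add: pick_ineq_def L_def d_def)
    then show ?thesis using d by (simp add: s_def field_simps)
  qed
  \<comment> \<open>The Cholesky vectors \<open>(d, 0)\<close> at \<open>x\<close> and
    \<open>(cnj L / d, sqrt s)\<close> at any other point; \<open>s\<close> is the Schur
    complement.\<close>
  define c :: "nat \<Rightarrow> 'p \<Rightarrow> complex" where
    "c = (\<lambda>k t. if k = 0 then (if t = x then complex_of_real d else cnj L / complex_of_real d)
        else (if t = x then 0 else complex_of_real (sqrt s)))"
  have cxx: "(\<Sum>k\<in>{0, 1}. c k x * cnj (c k x)) = complex_of_real (d\<^sup>2)"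
    by (simp add: c_def power2_eq_square)
  have cxy: "(\<Sum>k\<in>{0, 1}. c k x * cnj (c k y)) = L" "(\<Sum>k\<in>{0, 1}. c k y * cnj (c k x)) = cnj L"
    if "x \<noteq> y" using that d by (auto simp: c_def)
  have cyy: "(\<Sum>k\<in>{0, 1}. c k y * cnj (c k y)) = complex_of_real ((delta H z y)\<^sup>2)" if "x \<noteq> y"
  proof -
    have "complex_of_real (sqrt s) * complex_of_real (sqrt s) = complex_of_real s"
      using s by (simp flip: of_real_mult)
    then have "(\<Sum>k\<in>{0, 1}. c k y * cnj (c k y))
        = complex_of_real ((cmod L)\<^sup>2) / complex_of_real (d\<^sup>2) + complex_of_real s"
      unfolding complex_norm_square using that by (simp add: c_def power2_eq_square mult_ac)
    also have "\<dots> = complex_of_real ((cmod L)\<^sup>2 / d\<^sup>2 + s)" by simp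
    finally show ?thesis by (simp add: s_def)
  qed
  have "gram H a b - gram H a z * gram H z b / gram H z z
      = gram H a b * (\<Sum>k\<in>{0, 1}. c k a * cnj (c k b))" if "a \<in> Y" "b \<in> Y" for a b
  proof -
    have "1 - base_ratio H z a b = (\<Sum>k\<in>{0, 1}. c k a * cnj (c k b))"
    proof (cases "x = y")
      case True
      then show ?thesis using that Y diag[of x] cxx by (auto simp: d_def)
    next
      case False
      consider "a = x" "b = x" | "a = x" "b = y" | "a = y" "b = x" | "a = y" "b = y"
        using \<open>a \<in> Y\<close> \<open>b \<in> Y\<close> Y by blast
      then show ?thesis
      proof cases
        case 1 then show ?thesis using diag[of x] cxx Y by (simp only: d_def insertI1)
      next
        case 2 then show ?thesis using cxy(1)[OF False] by (simp only: L_def)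
      next
        case 3 then show ?thesis using cxy(2)[OF False] Lyx by (simp only:)
      next
        case 4 then show ?thesis using diag[of y] cyy[OF False] Y by (simp only: insertI1 insertI2)
      qed
    qed
    then show ?thesis using entry[OF that] by (simp only:)
  qed
  then show ?thesis by blast
qed

text \<open>Points are adjoined one at a time, each serving as the base point of its own step; this
  is why the inequality is required for every choice of \<open>z\<close>.\<close>

lemma pick_ineq_imp_complete_pick:
  assumes pts: "points H \<subseteq> {x1, x2, x3}"
    and nz: "\<And>x y. x \<in> points H \<Longrightarrow> y \<in> points H \<Longrightarrow> gram H x y \<noteq> 0"
    and ineq: "\<And>x y z. x \<in> points H \<Longrightarrow> y \<in> points H \<Longrightarrow> z \<in> points H \<Longrightarrow> distinct [x, y, z] \<Longrightarrow> pick_ineq z x y"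
  shows "complete_pick_property H"
  unfolding complete_pick_property_def
proof (intro allI impI)
  fix p q Y \<phi>
  assume Y: "Y \<subseteq> points H" and norm: "mat_mult_norm (subrkhs H Y) p q \<phi> = 1"
  \<comment> \<open>On the empty set every symbol has norm 0, so a symbol of norm one lives on a
    nonempty \<open>Y\<close>, as \<open>kernel_factor\<close> demands.\<close>
  have "Y \<noteq> {}"
  proof
    assume "Y = {}"
    then have "adj_bound (gram H) Y p q \<phi> 0" by (simp add: adj_bound_def qform_def)
    then show False using norm mat_mult_norm_sub_le_iff[OF Y, of 0 p q \<phi>] by simp
  qed
  have bound: "adj_bound (gram H) Y p q \<phi> 1"
    using norm mat_mult_norm_sub_le_iff[OF Y, of 1 p q \<phi>] by simp
  have "\<exists>\<phi>'. (\<forall>y\<in>Y. \<phi>' y = \<phi> y) \<and> adj_bound (gram H) (Y \<union> T) p q \<phi>' 1"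
    if "finite T" "T \<subseteq> points H" for T
    using that
  proof (induction T rule: finite_induct)
    case empty
    then show ?case using bound by auto
  next
    case (insert z T)
    then obtain \<phi>1 where \<phi>1: "\<forall>y\<in>Y. \<phi>1 y = \<phi> y" "adj_bound (gram H) (Y \<union> T) p q \<phi>1 1" by auto
    show ?case
    proof (cases "z \<in> Y \<union> T")
      case True
      then have "Y \<union> insert z T = Y \<union> T" by auto
      then show ?thesis using \<phi>1 by auto
    next
      case False
      have sub: "Y \<union> T \<subseteq> points H" "z \<in> points H" using insert.prems Y by auto
      obtain c :: "nat \<Rightarrow> 'p \<Rightarrow> complex" where c: "\<And>x y. x \<in> Y \<union> T \<Longrightarrow> y \<in> Y \<union> T \<Longrightarrow>
          gram H x y - gram H x z * gram H z y / gram H z z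
            = gram H x y * (\<Sum>k\<in>{0, 1}. c k x * cnj (c k y))"
        using kernel_factor[OF pts sub(1), of z] sub(2) False \<open>Y \<noteq> {}\<close> nz ineq by blast
      have "finite (Y \<union> T)" using sub finite_points finite_subset by blast
      moreover have "psd_on (insert z (Y \<union> T)) (gram H)"
        using psd_on_subset[OF psd_gram finite_points] sub by simp
      ultimately obtain \<phi>2 where "\<forall>y\<in>Y \<union> T. \<phi>2 y = \<phi>1 y"
        "adj_bound (gram H) (insert z (Y \<union> T)) p q \<phi>2 1"
        using adj_bound_extend[OF _ False _ gram_pos[OF sub(2)] c \<phi>1(2)] by blast
      then show ?thesis using \<phi>1(1) by (intro exI[of _ \<phi>2]) auto
    qed
  qed
  from this[OF finite_points subset_refl] obtain \<phi>' where
    \<phi>': "\<forall>y\<in>Y. \<phi>' y = \<phi> y" "adj_bound (gram H) (points H) p q \<phi>' 1"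
    using Y by (auto simp: Un_absorb1)
  have "mat_mult_norm H p q \<phi>' \<le> 1" using \<phi>'(2) by (simp add: mat_mult_norm_le_iff)
  moreover have "1 \<le> mat_mult_norm H p q \<phi>'"
    using mat_mult_norm_restrict[OF Y, of p q \<phi>' \<phi>] \<phi>'(1) norm by simp
  ultimately show "\<exists>\<phi>'. (\<forall>y\<in>Y. \<forall>i<p. \<forall>j<q. \<phi>' y i j = \<phi> y i j) \<and> mat_mult_norm H p q \<phi>' = 1"
    using \<phi>'(1) by (intro exI[of _ \<phi>']) auto
qed

end

section \<open>The Drury--Arveson model\<close>

lemma rescaling_base_ratio:
  assumes "rescaling \<Xi> H H'" "x \<in> points H" "y \<in> points H" "z \<in> points H"
  shows "base_ratio H' (\<Xi> z) (\<Xi> x) (\<Xi> y) = base_ratio H z x y"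
proof -
  obtain \<gamma> where \<gamma>: "\<And>x. x \<in> points H \<Longrightarrow> \<gamma> x \<noteq> 0"
    "\<And>x y. x \<in> points H \<Longrightarrow> y \<in> points H \<Longrightarrow> gram H' (\<Xi> x) (\<Xi> y) = \<gamma> x * cnj (\<gamma> y) * gram H x y"
    using assms(1) unfolding rescaling_def by blast
  have "base_ratio H' (\<Xi> z) (\<Xi> x) (\<Xi> y)
      = (\<gamma> x * cnj (\<gamma> y) * \<gamma> z * cnj (\<gamma> z)) * (gram H x z * gram H z y)
      / ((\<gamma> x * cnj (\<gamma> y) * \<gamma> z * cnj (\<gamma> z)) * (gram H x y * gram H z z))"
    using assms by (simp add: base_ratio_def \<gamma>(2) mult_ac)
  then show ?thesis using \<gamma>(1) assms by (simp add: base_ratio_def)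
qed

text \<open>The vector \<open>\<gamma>\<close> is forced up to a unimodular constant by the requirement at the base point \<open>z\<close>.\<close>

lemma rescaling_of_base_ratio:
  assumes bij: "bij_betw \<Xi> (points H) (points H')" and z: "z \<in> points H"
    and herm: "\<And>x y. x \<in> points H \<Longrightarrow> y \<in> points H \<Longrightarrow> gram H y x = cnj (gram H x y)"
    and herm': "\<And>x y. x \<in> points H' \<Longrightarrow> y \<in> points H' \<Longrightarrow> gram H' y x = cnj (gram H' x y)"
    and nz: "\<And>x y. x \<in> points H \<Longrightarrow> y \<in> points H \<Longrightarrow> gram H x y \<noteq> 0"
    and nz': "\<And>x y. x \<in> points H' \<Longrightarrow> y \<in> points H' \<Longrightarrow> gram H' x y \<noteq> 0"
    and pos: "0 < Re (gram H z z)" "0 < Re (gram H' (\<Xi> z) (\<Xi> z))"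
    and ratio: "\<And>x y. x \<in> points H \<Longrightarrow> y \<in> points H \<Longrightarrow>
      base_ratio H' (\<Xi> z) (\<Xi> x) (\<Xi> y) = base_ratio H z x y"
  shows "rescaling \<Xi> H H'"
proof -
  have \<Xi>: "\<Xi> x \<in> points H'" if "x \<in> points H" for x using bij that bij_betwE by blast
  define A A' where "A = Re (gram H z z)" and "A' = Re (gram H' (\<Xi> z) (\<Xi> z))"
  have A: "gram H z z = complex_of_real A" "gram H' (\<Xi> z) (\<Xi> z) = complex_of_real A'"
    using herm[OF z z] herm'[OF \<Xi>[OF z] \<Xi>[OF z]] by (simp_all add: A_def A'_def complex_eq_iff)
  \<comment> \<open>The required identity with \<open>y = z\<close> determines
    \<open>\<gamma> x\<close> from \<open>\<gamma> z\<close>. The positive choice for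
    \<open>\<gamma> z\<close> is \<open>sqrt (A' / A)\<close>, and \<open>g\<close> is its
    reciprocal.\<close>
  define g where "g = complex_of_real (sqrt (A / A'))"
  have gg: "g * g = complex_of_real A / complex_of_real A'"
    using pos unfolding g_def of_real_mult[symmetric] by (simp add: A_def A'_def)
  have cg: "cnj g = g" by (simp add: g_def)
  have Ane: "complex_of_real A \<noteq> 0" "complex_of_real A' \<noteq> 0" using pos by (auto simp: A_def A'_def)
  define \<gamma> where "\<gamma> = (\<lambda>x. gram H' (\<Xi> x) (\<Xi> z) / gram H x z * g)"
  have "gram H' (\<Xi> x) (\<Xi> y) = \<gamma> x * cnj (\<gamma> y) * gram H x y" if x: "x \<in> points H" and y: "y \<in> points H" for x y
  proof -
    have cy: "cnj (\<gamma> y) = gram H' (\<Xi> z) (\<Xi> y) / gram H z y * g"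
      unfolding \<gamma>_def complex_cnj_mult complex_cnj_divide cg herm[OF y z] herm'[OF \<Xi>[OF y] \<Xi>[OF z]] ..
    have "gram H' (\<Xi> x) (\<Xi> z) * gram H' (\<Xi> z) (\<Xi> y) * (gram H x y * complex_of_real A)
        = gram H x z * gram H z y * (gram H' (\<Xi> x) (\<Xi> y) * complex_of_real A')"
      using ratio[OF x y] nz[OF x y] nz'[OF \<Xi>[OF x] \<Xi>[OF y]] Ane
      by (simp add: base_ratio_def A frac_eq_eq)
    then have "gram H' (\<Xi> x) (\<Xi> y) = gram H' (\<Xi> x) (\<Xi> z) * gram H' (\<Xi> z) (\<Xi> y) * (gram H x y * complex_of_real A)
        / (gram H x z * gram H z y * complex_of_real A')"
      using nz[OF x z] nz[OF z y] Ane by (simp add: field_simps)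
    also have "\<dots> = gram H' (\<Xi> x) (\<Xi> z) * gram H' (\<Xi> z) (\<Xi> y) * gram H x y / (gram H x z * gram H z y) * (g * g)"
      unfolding gg by simp
    also have "\<dots> = \<gamma> x * cnj (\<gamma> y) * gram H x y"
      unfolding cy by (simp add: \<gamma>_def)
    finally show ?thesis .
  qed
  moreover have "\<gamma> x \<noteq> 0" if "x \<in> points H" for x
  proof -
    have "g \<noteq> 0" using gg Ane by auto
    then show ?thesis using nz[OF that z] nz'[OF \<Xi>[OF that] \<Xi>[OF z]] by (simp add: \<gamma>_def)
  qed
  ultimately show ?thesis unfolding rescaling_def using bij by blast
qed

context fin_rkhs
begin

lemma base_ratio_base:
  assumes "z \<in> points H" "x \<in> points H" "gram H x z \<noteq> 0"
  shows "base_ratio H z z x = 1" "base_ratio H z x z = 1"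
proof -
  have "gram H z x \<noteq> 0" "gram H z z \<noteq> 0" using gram_herm[of x z] gram_pos[of z] assms by auto
  then show "base_ratio H z z x = 1" "base_ratio H z x z = 1"
    using assms by (simp_all add: base_ratio_def)
qed

lemma cmod_base_ratio:
  assumes "x \<in> points H" "y \<in> points H" "z \<in> points H"
  shows "cmod (base_ratio H z x y) = cmod (ngram H z x) * cmod (ngram H z y) / cmod (ngram H x y)"
proof -
  define a b c where "a = sqrt (Re (gram H x x))" and "b = sqrt (Re (gram H y y))" and "c = sqrt (Re (gram H z z))"
  have pos: "a > 0" "b > 0" "c > 0" using gram_pos assms by (auto simp: a_def b_def c_def)
  have "gram H z z = complex_of_real (c * c)"
    using gram_self[OF assms(3)] gram_pos[OF assms(3)] by (simp add: c_def)
  then have zz: "cmod (gram H z z) = c * c" using pos by (simp add: norm_mult)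
  show ?thesis
    using pos cmod_gram_commute[OF assms(1,3)]
    by (simp add: base_ratio_def ngram_def norm_divide norm_mult zz
        flip: a_def b_def c_def)
qed

lemma ngram_self:
  assumes "x \<in> points H"
  shows "ngram H x x = 1"
proof -
  have "complex_of_real (sqrt (Re (gram H x x)) * sqrt (Re (gram H x x))) = gram H x x"
    using gram_self[OF assms, symmetric] gram_pos[OF assms] by simp
  moreover have "gram H x x \<noteq> 0" using gram_pos[OF assms] by auto
  ultimately show ?thesis by (simp add: ngram_def)
qed

lemma cmod_ngram_delta:
  assumes "x \<in> points H" "y \<in> points H" "x \<noteq> y"
  shows "cmod (ngram H x y) = sqrt (1 - (delta H x y)\<^sup>2)"
proof -
  have "1 - (delta H x y)\<^sup>2 = (cmod (ngram H x y))\<^sup>2"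
    using delta_square[OF assms] cmod_ngram_square[OF assms(1,2)] by simp
  then show ?thesis by simp
qed

text \<open>Up to a positive factor the ratio is the conjugate cyclic product, which gives its
  argument; the modulus comes from the normalised kernels. Hence distances and angle determine the
  off-diagonal entry of \<open>L\<close>.\<close>

lemma base_ratio_angle:
  assumes "x \<in> points H" "y \<in> points H" "z \<in> points H" "distinct [x, y, z]" and "gram H y z \<noteq> 0"
  shows "base_ratio H x y z = complex_of_real (sqrt (1 - (delta H x y)\<^sup>2) * sqrt (1 - (delta H x z)\<^sup>2)
     / sqrt (1 - (delta H y z)\<^sup>2)) * cis (- angle H x y z)"
proof -
  define T where "T = gram H x y * gram H y z * gram H z x"
  define r where "r = 1 / ((cmod (gram H y z))\<^sup>2 * Re (gram H x x))"
  have r: "r > 0" using assms gram_pos[OF assms(1)] by (simp add: r_def)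
  have "base_ratio H x y z = complex_of_real r * cnj T"
    unfolding r_def T_def base_ratio_def of_real_divide of_real_mult complex_norm_square
      gram_self[OF assms(1), symmetric] complex_cnj_mult
      gram_herm[OF assms(1,2), symmetric] gram_herm[OF assms(2,3), symmetric] gram_herm[OF assms(3,1), symmetric]
    using assms(5) gram_herm[OF assms(2,3)] by simp
  also have "cnj T = complex_of_real (cmod T) * cis (- Arg T)"
    by (metis cis_cnj complex_cnj_complex_of_real complex_cnj_mult rcis_cmod_Arg rcis_def)
  finally have eq: "base_ratio H x y z = complex_of_real (r * cmod T) * cis (- Arg T)" by simp
  then have "cmod (base_ratio H x y z) = r * cmod T" using r by (simp add: norm_mult)
  then have "r * cmod T = sqrt (1 - (delta H x y)\<^sup>2) * sqrt (1 - (delta H x z)\<^sup>2) / sqrt (1 - (delta H y z)\<^sup>2)"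
    using cmod_base_ratio[OF assms(2,3,1)] cmod_ngram_delta[OF assms(1,2)] cmod_ngram_delta[OF assms(1,3)]
      cmod_ngram_delta[OF assms(2,3)] assms(4) by simp
  then show ?thesis using eq by (simp add: angle_def T_def)
qed

lemma LF_le_delta_iff:
  assumes "x \<in> points H" "y \<in> points H" "z \<in> points H" "x \<noteq> y"
  shows "(LF H x y z)\<^sup>2 \<le> (delta H x z)\<^sup>2 \<longleftrightarrow> pick_ineq x y z"
proof -
  have d: "delta H x y > 0" using delta_pos assms by simp
  have "LF H x y z = cmod (1 - base_ratio H x y z) / delta H x y"
    by (simp add: LF_def base_ratio_def)
  then show ?thesis
    using d by (simp add: pick_ineq_def power_divide divide_le_eq mult.commute)
qed

end

section \<open>Points of the ball realising the normalised Gram matrix\<close>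

lemma cdot_commute: "cdot w z = cnj (cdot z w)"
  by (simp add: cdot_def mult.commute)

text \<open>The kernel at the origin is constantly one on the ball, so the Gram matrix is already
  normalised there, and \<open>L\<close> is the matrix of inner products of the points
  themselves.\<close>

lemma base_ratio_DA:
  assumes Y: "finite Y" "Y \<subseteq> ball 0 1" and "0 \<in> Y" "u \<in> Y" "v \<in> Y"
  shows "base_ratio (DA Y) 0 u v = 1 - cdot v u"
  using assms by (simp add: base_ratio_def gram_DA cdot_def[of 0] cdot_def[of _ 0])

lemma norm_complex_vec2: "(norm (vector [a, b] :: complex ^ 2))\<^sup>2 = (cmod a)\<^sup>2 + (cmod b)\<^sup>2"
  by (simp add: norm_vec_def L2_set_def sum_2)

lemma cdot_vec2: "cdot (vector [a, b] :: complex ^ 2) (vector [c, d]) = a * cnj c + b * cnj d"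
  by (simp add: cdot_def sum_2)

lemma vector_zero_2: "(vector [0, 0] :: complex ^ 2) = 0"
  by (simp add: vec_eq_iff forall_2)

lemma DA2_model_base_ratio:
  assumes H: "three_point_rkhs H x1 x2 x3" and model: "DA2_model H x1 x2 x3 w s t \<Phi>"
    and uv: "u \<in> points H" "v \<in> points H"
  shows "base_ratio H x1 u v = 1 - cdot (\<Phi> v) (\<Phi> u)"
proof -
  have pts: "points H = {x1, x2, x3}" using H by (simp add: three_point_rkhs_def)
  have 0: "\<Phi> x1 = 0" and r: "rescaling \<Phi> H (DA (\<Phi> ` points H))" and sub: "\<Phi> ` points H \<subseteq> ball 0 1"
    using model by (auto simp: DA2_model_def vector_zero_2)
  have "base_ratio (DA (\<Phi> ` points H)) (\<Phi> x1) (\<Phi> u) (\<Phi> v) = base_ratio H x1 u v"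
    using rescaling_base_ratio[OF r uv] pts by simp
  moreover have "base_ratio (DA (\<Phi> ` points H)) 0 (\<Phi> u) (\<Phi> v) = 1 - cdot (\<Phi> v) (\<Phi> u)"
    using sub uv pts 0 by (intro base_ratio_DA) (auto intro: rev_image_eqI)
  ultimately show ?thesis by (simp add: 0)
qed

text \<open>Obtained by comparing \<open>L\<close> with the inner products of the model points. The
  equations are triangular in \<open>s\<close>, \<open>w\<close>, \<open>t\<close>, which later
  gives uniqueness.\<close>

lemma DA2_model_parameters:
  assumes H: "three_point_rkhs H x1 x2 x3" and model: "DA2_model H x1 x2 x3 w s t \<Phi>"
  shows "s = delta H x1 x2" "w * complex_of_real s = 1 - base_ratio H x1 x2 x3"
    "(cmod w)\<^sup>2 + t\<^sup>2 = (delta H x1 x3)\<^sup>2"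
proof -
  interpret fin_rkhs H using H by (simp add: three_point_rkhs_def)
  have pts: "x1 \<in> points H" "x2 \<in> points H" "x3 \<in> points H" "x1 \<noteq> x2" "x1 \<noteq> x3"
    using H by (auto simp: three_point_rkhs_def)
  have \<Phi>: "s > 0" "\<Phi> x2 = vector [complex_of_real s, 0]" "\<Phi> x3 = vector [w, complex_of_real t]"
    using model by (auto simp: DA2_model_def)
  note ratio = DA2_model_base_ratio[OF H model]
  have "complex_of_real (s\<^sup>2) = complex_of_real ((delta H x1 x2)\<^sup>2)"
    using ratio[OF pts(2,2)] base_ratio_diag[OF pts(2,1,4)]
    by (simp add: \<Phi> cdot_vec2 power2_eq_square)
  then have "s\<^sup>2 = (delta H x1 x2)\<^sup>2" by (simp only: of_real_eq_iff)
  then show "s = delta H x1 x2"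
    by (rule power2_eq_imp_eq) (use \<Phi>(1) delta_pos[OF pts(1,2,4)] in simp_all)
  show "w * complex_of_real s = 1 - base_ratio H x1 x2 x3"
    using ratio[OF pts(2,3)] by (simp add: \<Phi> cdot_vec2)
  have "cdot (\<Phi> x3) (\<Phi> x3) = complex_of_real ((delta H x1 x3)\<^sup>2)"
    using ratio[OF pts(3,3)] base_ratio_diag[OF pts(3,1,5)] by simp
  then have "complex_of_real ((cmod w)\<^sup>2 + t\<^sup>2) = complex_of_real ((delta H x1 x3)\<^sup>2)"
    unfolding of_real_add complex_norm_square by (simp add: \<Phi> cdot_vec2 power2_eq_square)
  then show "(cmod w)\<^sup>2 + t\<^sup>2 = (delta H x1 x3)\<^sup>2" by (simp only: of_real_eq_iff)
qed

text \<open>Cauchy-Schwarz for the two nonzero model points; the slack is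
  \<open>t\<^sup>2 * s\<^sup>2\<close>.\<close>

lemma DA2_model_imp_pick_ineq:
  assumes H: "three_point_rkhs H x1 x2 x3" and model: "DA2_model H x1 x2 x3 w s t \<Phi>"
  shows "fin_rkhs.pick_ineq H x1 x2 x3"
proof -
  interpret fin_rkhs H using H by (simp add: three_point_rkhs_def)
  note par = DA2_model_parameters[OF H model]
  have "(cmod (1 - base_ratio H x1 x2 x3))\<^sup>2 = (cmod w)\<^sup>2 * s\<^sup>2"
    unfolding par(2)[symmetric] by (simp add: norm_mult power_mult_distrib)
  also have "\<dots> \<le> ((cmod w)\<^sup>2 + t\<^sup>2) * s\<^sup>2" by (intro mult_right_mono) auto
  finally show ?thesis unfolding pick_ineq_def par(3) par(1) by (simp add: mult.commute)
qed

text \<open>The equations of \<open>DA2_model_parameters\<close> are solved for \<open>s\<close>,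
  \<open>w\<close>, \<open>t\<close> in turn; the inequality says exactly that the radicand for
  \<open>t\<close> is nonnegative.\<close>

lemma pick_ineq_imp_DA2_model:
  assumes H: "three_point_rkhs H x1 x2 x3" and ineq: "fin_rkhs.pick_ineq H x1 x2 x3"
  shows "\<exists>w s t \<Phi>. DA2_model H x1 x2 x3 w s t \<Phi>"
proof -
  interpret fin_rkhs H using H by (simp add: three_point_rkhs_def)
  have pts: "points H = {x1, x2, x3}" and dist: "x1 \<noteq> x2" "x1 \<noteq> x3" "x2 \<noteq> x3"
    and nz: "\<And>x y. x \<in> points H \<Longrightarrow> y \<in> points H \<Longrightarrow> gram H x y \<noteq> 0"
    using H by (auto simp: three_point_rkhs_def)
  have P: "x1 \<in> points H" "x2 \<in> points H" "x3 \<in> points H" using pts by auto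
  define s where "s = delta H x1 x2"
  define w where "w = (1 - base_ratio H x1 x2 x3) / complex_of_real s"
  define t where "t = sqrt ((delta H x1 x3)\<^sup>2 - (cmod w)\<^sup>2)"
  have s: "s > 0" using delta_pos P dist by (simp add: s_def)
  have "(cmod w)\<^sup>2 \<le> (delta H x1 x3)\<^sup>2"
    using ineq s unfolding pick_ineq_def s_def[symmetric]
    by (simp add: w_def norm_divide power_divide divide_le_eq mult.commute)
  then have t: "t \<ge> 0" "(cmod w)\<^sup>2 + t\<^sup>2 = (delta H x1 x3)\<^sup>2" by (auto simp: t_def)
  have ws: "w * complex_of_real s = 1 - base_ratio H x1 x2 x3" using s by (simp add: w_def)
  define \<Phi> :: "'a \<Rightarrow> complex ^ 2" where
    "\<Phi> = (\<lambda>x. if x = x1 then vector [0, 0] else if x = x2 then vector [complex_of_real s, 0]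
       else vector [w, complex_of_real t])"
  have \<Phi>: "\<Phi> x1 = vector [0, 0]" "\<Phi> x2 = vector [complex_of_real s, 0]"
    "\<Phi> x3 = vector [w, complex_of_real t]"
    using dist by (simp_all add: \<Phi>_def)
  have c11: "base_ratio H x1 x1 y = 1" "base_ratio H x1 y x1 = 1" if "y \<in> points H" for y
    using base_ratio_base[OF P(1) that nz[OF that P(1)]] by auto
  have dot22: "base_ratio H x1 x2 x2 = 1 - cdot (\<Phi> x2) (\<Phi> x2)"
    using base_ratio_diag[OF P(2,1)] dist by (simp add: \<Phi> cdot_vec2 power2_eq_square flip: s_def)
  have dot33: "base_ratio H x1 x3 x3 = 1 - cdot (\<Phi> x3) (\<Phi> x3)"
  proof -
    have "complex_of_real ((delta H x1 x3)\<^sup>2) = w * cnj w + complex_of_real t * complex_of_real t"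
      unfolding t(2)[symmetric] of_real_add complex_norm_square by (simp add: power2_eq_square)
    then show ?thesis using base_ratio_diag[OF P(3,1)] dist by (simp add: \<Phi> cdot_vec2)
  qed
  have dot23: "base_ratio H x1 x2 x3 = 1 - cdot (\<Phi> x3) (\<Phi> x2)"
    using ws by (simp add: \<Phi> cdot_vec2)
  have dot32: "base_ratio H x1 x3 x2 = 1 - cdot (\<Phi> x2) (\<Phi> x3)"
    unfolding base_ratio_commute[OF P(2,3,1)] dot23 cdot_commute[of "\<Phi> x2"] by simp
  have dot: "base_ratio H x1 u v = 1 - cdot (\<Phi> v) (\<Phi> u)" if "u \<in> points H" "v \<in> points H" for u v
    using that c11 dot22 dot23 dot32 dot33 unfolding pts
    by (auto simp: \<Phi>(1) vector_zero_2 cdot_def[of 0] cdot_def[of _ 0])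
  \<comment> \<open>Coinciding images would force the normalised kernel of \<open>u\<close> and
    \<open>v\<close> to have modulus one, against their linear independence.\<close>
  have inj: "inj_on \<Phi> (points H)"
  proof (rule inj_onI, rule ccontr)
    fix u v assume uv: "u \<in> points H" "v \<in> points H" and eq: "\<Phi> u = \<Phi> v" and ne: "u \<noteq> v"
    have ratio_eq: "base_ratio H x1 u u = base_ratio H x1 u v" "base_ratio H x1 v v = base_ratio H x1 u v"
      using dot uv eq by auto
    define n where "n = cmod (ngram H u v)"
    have nself: "cmod (ngram H u u) = 1" "cmod (ngram H v v) = 1"
      using ngram_self uv by simp_all
    have npos: "0 < cmod (ngram H x1 u)" "0 < cmod (ngram H x1 v)" "n > 0"
      using nz P uv gram_pos[OF P(1)] gram_pos[OF uv(1)] gram_pos[OF uv(2)]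
      by (auto simp: n_def ngram_def)
    have "cmod (ngram H x1 u) * cmod (ngram H x1 u) = cmod (ngram H x1 u) * cmod (ngram H x1 v) / n"
      "cmod (ngram H x1 v) * cmod (ngram H x1 v) = cmod (ngram H x1 u) * cmod (ngram H x1 v) / n"
      using ratio_eq[THEN arg_cong[of _ _ cmod]] uv P by (simp_all add: cmod_base_ratio nself n_def)
    then have "n * cmod (ngram H x1 u) = cmod (ngram H x1 v)" "n * cmod (ngram H x1 v) = cmod (ngram H x1 u)"
      using npos by (auto simp: field_simps)
    then have "n * n = 1" using npos by (metis mult.assoc mult_cancel_right2 less_irrefl)
    then have "delta H u v = 0" by (simp add: delta_def power2_eq_square flip: n_def)
    then show False using delta_pos[OF uv ne] by simp
  qed
  have "norm (\<Phi> u) < 1" if "u \<in> points H" for u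
  proof -
    \<comment> \<open>Squared norms of the nonzero model points are squared distances from
      \<open>x1\<close>, strictly below one because no two kernels are orthogonal.\<close>
    have "(delta H x1 x2)\<^sup>2 < 1" "(delta H x1 x3)\<^sup>2 < 1"
      using delta_square P dist nz gram_pos by simp_all
    then have "(norm (\<Phi> u))\<^sup>2 < 1"
      using that t(2) unfolding pts by (auto simp: \<Phi> norm_complex_vec2 s_def)
    then show ?thesis by (simp add: power_less_one_iff abs_square_less_1)
  qed
  then have ball: "\<Phi> ` points H \<subseteq> ball 0 1" by auto
  define Y where "Y = \<Phi> ` points H"
  have fY: "finite Y" and YB: "Y \<subseteq> ball 0 1" and Y0: "0 \<in> Y"
    using finite_points ball P(1) \<Phi>(1) by (auto simp: Y_def vector_zero_2 intro: rev_image_eqI)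
  have ptsY: "points (DA Y) = Y" by (simp add: DA_def)
  have "rescaling \<Phi> H (DA Y)"
  proof (rule rescaling_of_base_ratio[where z = x1])
    show "bij_betw \<Phi> (points H) (points (DA Y))" unfolding ptsY bij_betw_def using inj by (simp add: Y_def)
    show "gram (DA Y) b a = cnj (gram (DA Y) a b)" if "a \<in> points (DA Y)" "b \<in> points (DA Y)" for a b
      using that cdot_commute[of a b] by (simp add: ptsY gram_DA[OF fY YB])
    show "gram (DA Y) a b \<noteq> 0" if "a \<in> points (DA Y)" "b \<in> points (DA Y)" for a b
    proof -
      obtain u v where uv: "u \<in> points H" "v \<in> points H" "a = \<Phi> u" "b = \<Phi> v"
        using \<open>a \<in> points (DA Y)\<close> \<open>b \<in> points (DA Y)\<close> unfolding ptsY by (auto simp: Y_def)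
      \<comment> \<open>Division by zero yields 0, so a nonzero Gram entry requires a nonzero
        denominator; that denominator is this base ratio.\<close>
      have "base_ratio H x1 u v \<noteq> 0" using nz P uv by (simp add: base_ratio_def)
      then show ?thesis using dot uv that by (simp add: gram_DA[OF fY YB] ptsY)
    qed
    show "0 < Re (gram (DA Y) (\<Phi> x1) (\<Phi> x1))"
      using Y0 by (simp add: \<Phi>(1) vector_zero_2 gram_DA[OF fY YB] cdot_def)
    show "base_ratio (DA Y) (\<Phi> x1) (\<Phi> x) (\<Phi> y) = base_ratio H x1 x y" if "x \<in> points H" "y \<in> points H" for x y
      using dot[OF that] that base_ratio_DA[OF fY YB Y0, of "\<Phi> x" "\<Phi> y"]
      by (simp add: \<Phi>(1) vector_zero_2 Y_def)
    show "gram H y x = cnj (gram H x y)" if "x \<in> points H" "y \<in> points H" for x y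
      using gram_herm[OF that] .
  qed (use P nz gram_pos in auto)
  then have "DA2_model H x1 x2 x3 w s t \<Phi>"
    unfolding DA2_model_def using s t(1) \<Phi> ball by (simp add: Y_def)
  then show ?thesis by blast
qed

section \<open>Congruence and uniqueness\<close>

lemma ball_automorphism_id: "ball_automorphism (\<lambda>z :: complex ^ 'n. z)"
proof -
  \<comment> \<open>The inverse is given by \<open>inv_into\<close>, known to be the identity only
    on the ball, so holomorphy is shown for every map that is the identity there.\<close>
  have hol: "holomorphic_map_on f (ball 0 1)" if "\<And>z. z \<in> ball 0 1 \<Longrightarrow> f z = z"
    for f :: "complex ^ 'n \<Rightarrow> complex ^ 'n"
    unfolding holomorphic_map_on_def
  proof
    fix z :: "complex ^ 'n" assume z: "z \<in> ball 0 1"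
    have "(f has_derivative (\<lambda>v. v)) (at z)"
      by (rule has_derivative_transform_within_open[OF has_derivative_ident open_ball z]) (simp add: that)
    then show "\<exists>f'. (f has_derivative f') (at z) \<and> (\<forall>c v. f' (c *s v) = c *s f' v)" by auto
  qed
  have "inv_into (ball 0 1) (\<lambda>z :: complex ^ 'n. z) z = z" if "z \<in> ball 0 1" for z
    using inv_into_f_f[of "\<lambda>z. z" "ball 0 1" z] that by (simp add: inj_on_def)
  then show ?thesis unfolding ball_automorphism_def by (auto intro!: hol simp: bij_betw_def inj_on_def)
qed

lemma congruent_in_ball_refl: "congruent_in_ball zs zs"
  unfolding congruent_in_ball_def using ball_automorphism_id by (intro exI[of _ "\<lambda>z. z"]) simp

text \<open>The hypotheses fix every base ratio: those involving \<open>x1\<close> equal one, the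
  diagonal depends on the distances, and the remaining entry is a conjugate. Equal ratios at the
  base point give a rescaling.\<close>

lemma three_point_rescaling:
  assumes H: "three_point_rkhs H x1 x2 x3" and H': "three_point_rkhs H' y1 y2 y3"
    and eq: "delta H x1 x2 = delta H' y1 y2" "delta H x1 x3 = delta H' y1 y3"
      "base_ratio H x1 x2 x3 = base_ratio H' y1 y2 y3"
  shows "\<exists>\<Xi>. \<Xi> x1 = y1 \<and> \<Xi> x2 = y2 \<and> \<Xi> x3 = y3 \<and> rescaling \<Xi> H H'"
proof -
  interpret fin_rkhs H using H by (simp add: three_point_rkhs_def)
  interpret H': fin_rkhs H' using H' by (simp add: three_point_rkhs_def)
  have pts: "points H = {x1, x2, x3}" and dist: "x1 \<noteq> x2" "x1 \<noteq> x3" "x2 \<noteq> x3"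
    and nz: "\<And>x y. x \<in> points H \<Longrightarrow> y \<in> points H \<Longrightarrow> gram H x y \<noteq> 0"
    using H by (auto simp: three_point_rkhs_def)
  have pts': "points H' = {y1, y2, y3}" and dist': "y1 \<noteq> y2" "y1 \<noteq> y3" "y2 \<noteq> y3"
    and nz': "\<And>x y. x \<in> points H' \<Longrightarrow> y \<in> points H' \<Longrightarrow> gram H' x y \<noteq> 0"
    using H' by (auto simp: three_point_rkhs_def)
  have P: "x1 \<in> points H" "x2 \<in> points H" "x3 \<in> points H" using pts by auto
  have P': "y1 \<in> points H'" "y2 \<in> points H'" "y3 \<in> points H'" using pts' by auto
  define \<Xi> where "\<Xi> = (\<lambda>x. if x = x1 then y1 else if x = x2 then y2 else y3)"
  have \<Xi>: "\<Xi> x1 = y1" "\<Xi> x2 = y2" "\<Xi> x3 = y3" using dist by (auto simp: \<Xi>_def)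
  have diag: "base_ratio H' y1 y2 y2 = base_ratio H x1 x2 x2" "base_ratio H' y1 y3 y3 = base_ratio H x1 x3 x3"
    using base_ratio_diag[OF P(2,1)] base_ratio_diag[OF P(3,1)] H'.base_ratio_diag[OF P'(2,1)]
      H'.base_ratio_diag[OF P'(3,1)] eq dist dist' by simp_all
  have off: "base_ratio H' y1 y3 y2 = base_ratio H x1 x3 x2"
    unfolding base_ratio_commute[OF P(2,3,1)] H'.base_ratio_commute[OF P'(2,3,1)] eq(3) ..
  have base: "base_ratio H x1 x1 y = 1" "base_ratio H x1 y x1 = 1" if "y \<in> points H" for y
    using base_ratio_base[OF P(1) that nz[OF that P(1)]] by auto
  have base': "base_ratio H' y1 y1 y = 1" "base_ratio H' y1 y y1 = 1" if "y \<in> points H'" for y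
    using H'.base_ratio_base[OF P'(1) that nz'[OF that P'(1)]] by auto
  have "rescaling \<Xi> H H'"
  proof (rule rescaling_of_base_ratio[where z = x1])
    show "bij_betw \<Xi> (points H) (points H')"
      unfolding bij_betw_def inj_on_def pts pts' using dist dist' \<Xi> by auto
    show "base_ratio H' (\<Xi> x1) (\<Xi> x) (\<Xi> y) = base_ratio H x1 x y" if "x \<in> points H" "y \<in> points H" for x y
      using that base base' diag off eq(3) P P' unfolding pts pts' by (auto simp: \<Xi>)
    show "0 < Re (gram H x1 x1)" by (rule gram_pos[OF P(1)])
    show "0 < Re (gram H' (\<Xi> x1) (\<Xi> x1))" using H'.gram_pos[OF P'(1)] by (simp add: \<Xi>)
    show "gram H y x = cnj (gram H x y)" if "x \<in> points H" "y \<in> points H" for x y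
      using gram_herm[OF that] .
    show "gram H' y x = cnj (gram H' x y)" if "x \<in> points H'" "y \<in> points H'" for x y
      using H'.gram_herm[OF that] .
  qed (use P nz nz' in auto)
  then show ?thesis using \<Xi> by blast
qed

text \<open>Positivity of \<open>s\<close> allows division and the sign of \<open>t\<close> selects
  the square root, so the triangular system has only one solution.\<close>

lemma DA2_model_unique:
  assumes H: "three_point_rkhs H x1 x2 x3" and H': "three_point_rkhs H' y1 y2 y3"
    and eq: "delta H x1 x2 = delta H' y1 y2" "delta H x1 x3 = delta H' y1 y3"
      "base_ratio H x1 x2 x3 = base_ratio H' y1 y2 y3"
    and model: "DA2_model H x1 x2 x3 w s t \<Phi>" and model': "DA2_model H' y1 y2 y3 w' s' t' \<Phi>'"
  shows "[\<Phi> x1, \<Phi> x2, \<Phi> x3] = [\<Phi>' y1, \<Phi>' y2, \<Phi>' y3]"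
proof -
  note par = DA2_model_parameters[OF H model] and par' = DA2_model_parameters[OF H' model']
  have st: "s > 0" "t \<ge> 0" "t' \<ge> 0" using model model' by (auto simp: DA2_model_def)
  have s: "s = s'" using par(1) par'(1) eq(1) by simp
  have "w * complex_of_real s = w' * complex_of_real s" using par(2) par'(2) eq(3) s by simp
  then have w: "w = w'" using st by simp
  have "t\<^sup>2 = t'\<^sup>2" using par(3) par'(3) eq(2) w by simp
  then have "t = t'" using st by simp
  then show ?thesis using model model' s w by (simp add: DA2_model_def)
qed

section \<open>The equivalences and the uniqueness statement\<close>

theorem theorem16:
  fixes H :: "('p, 'v::ab_group_add) rkhs" and x1 x2 x3 :: 'p
  assumes "three_point_rkhs H x1 x2 x3"
  shows
    "((complete_pick_property H \<longleftrightarrow> pick_property H) \<and>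
      (pick_property H \<longleftrightarrow>
        (\<exists>x\<in>points H. \<exists>y\<in>points H. x \<noteq> y \<and> delta H x y = delta_G H x y)) \<and>
      ((\<exists>x\<in>points H. \<exists>y\<in>points H. x \<noteq> y \<and> delta H x y = delta_G H x y) \<longleftrightarrow>
        (LF H x1 x2 x3)\<^sup>2 \<le> (delta H x1 x3)\<^sup>2) \<and>
      ((LF H x1 x2 x3)\<^sup>2 \<le> (delta H x1 x3)\<^sup>2 \<longleftrightarrow>
        1 / (cmod (ngram H x1 x2))\<^sup>2 + 1 / (cmod (ngram H x2 x3))\<^sup>2
          + 1 / (cmod (ngram H x1 x3))\<^sup>2 - 1
        \<le> 2 * cos (angle H x1 x2 x3)
          / (cmod (ngram H x1 x2) * cmod (ngram H x2 x3) * cmod (ngram H x1 x3))) \<and>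
      (1 / (cmod (ngram H x1 x2))\<^sup>2 + 1 / (cmod (ngram H x2 x3))\<^sup>2
          + 1 / (cmod (ngram H x1 x3))\<^sup>2 - 1
        \<le> 2 * cos (angle H x1 x2 x3)
          / (cmod (ngram H x1 x2) * cmod (ngram H x2 x3) * cmod (ngram H x1 x3)) \<longleftrightarrow>
        (\<exists>w s t \<Phi>. DA2_model H x1 x2 x3 w s t \<Phi>))) \<and>
     (\<forall>(H' :: ('q, 'u::ab_group_add) rkhs) y1 y2 y3.
        three_point_rkhs H' y1 y2 y3 \<and>
        delta H x1 x2 = delta H' y1 y2 \<and> delta H x1 x3 = delta H' y1 y3 \<and>
        delta H x2 x3 = delta H' y2 y3 \<and> angle H x1 x2 x3 = angle H' y1 y2 y3 \<longrightarrow>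
        (\<exists>\<Xi>. \<Xi> x1 = y1 \<and> \<Xi> x2 = y2 \<and> \<Xi> x3 = y3 \<and> rescaling \<Xi> H H') \<and>
        (\<forall>w s t \<Phi> w' s' t' \<Phi>'.
           DA2_model H x1 x2 x3 w s t \<Phi> \<and> DA2_model H' y1 y2 y3 w' s' t' \<Phi>' \<longrightarrow>
           [\<Phi> x1, \<Phi> x2, \<Phi> x3] = [\<Phi>' y1, \<Phi>' y2, \<Phi>' y3] \<and>
           congruent_in_ball [\<Phi> x1, \<Phi> x2, \<Phi> x3] [\<Phi>' y1, \<Phi>' y2, \<Phi>' y3]))"
proof (intro conjI allI impI)
  interpret fin_rkhs H using assms by (simp add: three_point_rkhs_def)
  have pts: "points H = {x1, x2, x3}" and dist: "distinct [x1, x2, x3]"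
    and nz: "\<And>x y. x \<in> points H \<Longrightarrow> y \<in> points H \<Longrightarrow> gram H x y \<noteq> 0"
    using assms by (auto simp: three_point_rkhs_def)
  have P: "x1 \<in> points H" "x2 \<in> points H" "x3 \<in> points H" using pts by auto
  let ?Q = "pick_ineq x1 x2 x3"
  \<comment> \<open>Rotations together with the swap of the last two arguments reach all six orders
    of the points.\<close>
  have ineq: "pick_ineq z x y \<longleftrightarrow> ?Q"
    if "x \<in> points H" "y \<in> points H" "z \<in> points H" "distinct [x, y, z]" for x y z
  proof -
    have 1: "pick_ineq x3 x1 x2 = ?Q" "pick_ineq x1 x2 x3 = pick_ineq x2 x3 x1"
      using pick_ineq_rotate[OF P dist] pick_ineq_rotate[OF P(2,3,1)] dist nz P by auto
    have 2: "pick_ineq x3 x2 x1 = pick_ineq x3 x1 x2" "pick_ineq x1 x3 x2 = ?Q"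
      "pick_ineq x2 x1 x3 = pick_ineq x2 x3 x1"
      using pick_ineq_commute P by blast+
    show ?thesis using that dist 1 2 unfolding pts by auto
  qed
  have complete: "complete_pick_property H" if ?Q
    by (rule pick_ineq_imp_complete_pick[of x1 x2 x3]) (use that pts nz ineq in auto)
  have pick_delta: "\<exists>x\<in>points H. \<exists>y\<in>points H. x \<noteq> y \<and> delta H x y = delta_G H x y"
    if "pick_property H"
    using pick_imp_delta_eq[OF that P(1,2)] P dist by auto
  have delta_Q: ?Q if delta: "\<exists>x\<in>points H. \<exists>y\<in>points H. x \<noteq> y \<and> delta H x y = delta_G H x y"
  proof -
    obtain x y where xy: "x \<in> points H" "y \<in> points H" "x \<noteq> y" "delta H x y = delta_G H x y"
      using delta by blast
    then obtain z where z: "points H = {x, y, z}" "distinct [x, y, z]"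
      using dist unfolding pts by auto
    have "pick_ineq y z x"
      using delta_eq_imp_pick_ineq[OF z _ xy(4)] nz xy z(1) by simp
    then show ?thesis using ineq[of z x y] z by auto
  qed
  have LF_Q: "(LF H x1 x2 x3)\<^sup>2 \<le> (delta H x1 x3)\<^sup>2 \<longleftrightarrow> ?Q"
    using LF_le_delta_iff[OF P] dist by simp
  have cos_Q: "1 / (cmod (ngram H x1 x2))\<^sup>2 + 1 / (cmod (ngram H x2 x3))\<^sup>2
          + 1 / (cmod (ngram H x1 x3))\<^sup>2 - 1
        \<le> 2 * cos (angle H x1 x2 x3)
          / (cmod (ngram H x1 x2) * cmod (ngram H x2 x3) * cmod (ngram H x1 x3)) \<longleftrightarrow> ?Q"
    using pick_ineq_iff_cos_angle[OF P dist] nz P by simp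
  have model_Q: "(\<exists>w s t \<Phi>. DA2_model H x1 x2 x3 w s t \<Phi>) \<longleftrightarrow> ?Q"
    using DA2_model_imp_pick_ineq[OF assms] pick_ineq_imp_DA2_model[OF assms] by blast
  show "complete_pick_property H \<longleftrightarrow> pick_property H"
    using complete pick_delta delta_Q complete_pick_imp_pick by blast
  show "pick_property H \<longleftrightarrow> (\<exists>x\<in>points H. \<exists>y\<in>points H. x \<noteq> y \<and> delta H x y = delta_G H x y)"
    using complete pick_delta delta_Q complete_pick_imp_pick by blast
  show "(\<exists>x\<in>points H. \<exists>y\<in>points H. x \<noteq> y \<and> delta H x y = delta_G H x y) \<longleftrightarrow>
        (LF H x1 x2 x3)\<^sup>2 \<le> (delta H x1 x3)\<^sup>2"
    unfolding LF_Q using complete pick_delta delta_Q complete_pick_imp_pick by blast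
  show "(LF H x1 x2 x3)\<^sup>2 \<le> (delta H x1 x3)\<^sup>2 \<longleftrightarrow>
        1 / (cmod (ngram H x1 x2))\<^sup>2 + 1 / (cmod (ngram H x2 x3))\<^sup>2
          + 1 / (cmod (ngram H x1 x3))\<^sup>2 - 1
        \<le> 2 * cos (angle H x1 x2 x3)
          / (cmod (ngram H x1 x2) * cmod (ngram H x2 x3) * cmod (ngram H x1 x3))"
    unfolding LF_Q cos_Q ..
  show "1 / (cmod (ngram H x1 x2))\<^sup>2 + 1 / (cmod (ngram H x2 x3))\<^sup>2
          + 1 / (cmod (ngram H x1 x3))\<^sup>2 - 1
        \<le> 2 * cos (angle H x1 x2 x3)
          / (cmod (ngram H x1 x2) * cmod (ngram H x2 x3) * cmod (ngram H x1 x3)) \<longleftrightarrow>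
        (\<exists>w s t \<Phi>. DA2_model H x1 x2 x3 w s t \<Phi>)"
    unfolding cos_Q model_Q ..
  fix H' :: "('q, 'u) rkhs" and y1 y2 y3
  assume *: "three_point_rkhs H' y1 y2 y3 \<and>
        delta H x1 x2 = delta H' y1 y2 \<and> delta H x1 x3 = delta H' y1 y3 \<and>
        delta H x2 x3 = delta H' y2 y3 \<and> angle H x1 x2 x3 = angle H' y1 y2 y3"
  then have H': "three_point_rkhs H' y1 y2 y3" by blast
  interpret H': fin_rkhs H' using H' by (simp add: three_point_rkhs_def)
  have P': "y1 \<in> points H'" "y2 \<in> points H'" "y3 \<in> points H'" "distinct [y1, y2, y3]" "gram H' y2 y3 \<noteq> 0"
    using H' by (auto simp: three_point_rkhs_def)
  \<comment> \<open>The third distance and the angle enter only through this ratio.\<close>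
  have ratio: "base_ratio H x1 x2 x3 = base_ratio H' y1 y2 y3"
    unfolding base_ratio_angle[OF P dist nz[OF P(2,3)]] H'.base_ratio_angle[OF P'] using * by simp
  show "\<exists>\<Xi>. \<Xi> x1 = y1 \<and> \<Xi> x2 = y2 \<and> \<Xi> x3 = y3 \<and> rescaling \<Xi> H H'"
    using three_point_rescaling[OF assms H' _ _ ratio] * by blast
  fix w s t \<Phi> w' s' t' \<Phi>'
  assume models: "DA2_model H x1 x2 x3 w s t \<Phi> \<and> DA2_model H' y1 y2 y3 w' s' t' \<Phi>'"
  show unique: "[\<Phi> x1, \<Phi> x2, \<Phi> x3] = [\<Phi>' y1, \<Phi>' y2, \<Phi>' y3]"
    using DA2_model_unique[OF assms H' _ _ ratio] * models by blast
  \<comment> \<open>The two ordered triangles coincide, so the identity is a congruence.\<close>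
  show "congruent_in_ball [\<Phi> x1, \<Phi> x2, \<Phi> x3] [\<Phi>' y1, \<Phi>' y2, \<Phi>' y3]"
    unfolding unique by (rule congruent_in_ball_refl)
qed

end
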